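(* For even $m\ge2$, let $h_m\ge1$ with $h_m\le m$, and let $\Gamma_m=C_m\times G_m$ be the Cartesian product of the cycle $C_m$ of length $m$ and a Ramanujan Cayley graph $G_m$ of fixed degree greater than three with $|G_m|=m h_m$ vertices. Assume that $1\ll h_m\lesssim\log m$ as $m\to\infty$. Then $(\Gamma_m)$ is strongly uniformly transient, i.e. $$\lim_{s\to\infty}\limsup_{m\to\infty}\max_{o\in\Gamma_m}\mathbb{E}_o\big(L_o(t_{\mathrm{mix}}(1/4))-L_o(s)\big)=0,$$ but $(\Gamma_m)$ does not satisfy the diameter condition, i.e. $\mathrm{Diam}(\Gamma_m)^2\log|\Gamma_m|/|\Gamma_m|$ does not converge to $0$ as $m\to\infty$.
   Context: The parameter $m$ ranges over an infinite set of even integers for which the graphs $G_m$ exist. A connected $k$-regular graph is Ramanujan if every eigenvalue $\lambda$ of its adjacency matrix with $|\lambda|\ne k$ satisfies $|\lambda|\le2\sqrt{k-1}$. $h_m\gg1$ means $h_m\to\infty$; $h_m\lesssim\log m$ means $h_m=O(\log m)$. We write $\Gamma$ also for the vertex set of a graph $\Gamma$; $\mathrm{Diam}(\Gamma)$ is its diameter. On each graph, $X=(X_t)_{t\ge0}$ is the continuous-time simple random walk jumping at rate $1$ to a uniformly chosen neighbour, $p_t(x,\cdot)$ is the law of $X_t$ started from $x$, $\mathbb{E}_o$ the expectation started from $o$, $\pi$ the uniform distribution, $L_x(t)=\int_0^t\mathbf{1}_{\{X_u=x\}}\,du$, and $t_{\mathrm{mix}}(\varepsilon)=\inf\{t\ge0:\sup_x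 d_{\mathrm{TV}}(p_t(x,\cdot),\pi)\le\varepsilon\}$. *)

theory Defs
  imports
    "HOL-Probability.Probability"
    "HOL-Library.Landau_Symbols"
    "HOL-Algebra.Group"
    "Graph_Theory.Digraph_Component"
    "Graph_Theory.Shortest_Path"
begin

text \<open>
  A finite simple graph is a \<open>'v pair_pre_digraph\<close> satisfying \<open>pair_graph\<close>: a finite vertex set
  \<open>pverts\<close> with a symmetric irreflexive arc relation \<open>parcs\<close>.
\<close>

subsection \<open>Graphs\<close>

text \<open>For \<open>m = 2\<close> this is a single edge (no double edge).\<close>

definition cycle_graph :: "nat \<Rightarrow> nat pair_pre_digraph" where
  "cycle_graph m = \<lparr> pverts = {..<m},
     parcs = {(i, j). i < m \<and> j < m \<and> (j = (i + 1) mod m \<or> i = (j + 1) mod m)} \<rparr>"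

definition cartesian_product ::
    "'v pair_pre_digraph \<Rightarrow> 'w pair_pre_digraph \<Rightarrow> ('v \<times> 'w) pair_pre_digraph" where
  "cartesian_product G H = \<lparr> pverts = pverts G \<times> pverts H,
     parcs = {((a, x), (b, y)). (a, b) \<in> parcs G \<and> x = y \<and> x \<in> pverts H
                              \<or> a = b \<and> a \<in> pverts G \<and> (x, y) \<in> parcs H} \<rparr>"

text \<open>
  Connection sets of undirected, loop-free Cayley graphs. That such a set generates the group is
  equivalent to connectedness of the Cayley graph, which is part of being Ramanujan.
\<close>

definition connection_set :: "('a, 'b) monoid_scheme \<Rightarrow> 'a set \<Rightarrow> bool" where
  "connection_set G S \<longleftrightarrow>
     S \<subseteq> carrier G \<and> \<one>\<^bsub>G\<^esub> \<notin> S \<and> (\<forall>s\<in>S. inv\<^bsub>G\<^esub> s \<in> S)"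

definition cayley_graph :: "('a, 'b) monoid_scheme \<Rightarrow> 'a set \<Rightarrow> 'a pair_pre_digraph" where
  "cayley_graph G S = \<lparr> pverts = carrier G,
     parcs = {(x, x \<otimes>\<^bsub>G\<^esub> s) | x s. x \<in> carrier G \<and> s \<in> S} \<rparr>"

definition regular_graph :: "nat \<Rightarrow> 'v pair_pre_digraph \<Rightarrow> bool" where
  "regular_graph k G \<longleftrightarrow> (\<forall>x\<in>pverts G. out_degree (with_proj G) x = k)"

definition adjacency_matrix :: "'v pair_pre_digraph \<Rightarrow> 'v \<Rightarrow> 'v \<Rightarrow> real" where
  "adjacency_matrix G x y = (if (x, y) \<in> parcs G then 1 else 0)"

text \<open>
  The adjacency matrix is indexed by the vertex set, so eigenvectors are functions on it. It is
  symmetric, hence all its eigenvalues are real.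
\<close>

definition adjacency_eigenvalue :: "'v pair_pre_digraph \<Rightarrow> real \<Rightarrow> bool" where
  "adjacency_eigenvalue G r \<longleftrightarrow>
     (\<exists>f. (\<exists>x\<in>pverts G. f x \<noteq> 0) \<and>
          (\<forall>x\<in>pverts G. (\<Sum>y\<in>pverts G. adjacency_matrix G x y * f y) = r * f x))"

definition ramanujan :: "nat \<Rightarrow> 'v pair_pre_digraph \<Rightarrow> bool" where
  "ramanujan k G \<longleftrightarrow>
     pair_graph G \<and> Digraph_Component.connected (with_proj G) \<and> regular_graph k G \<and>
     (\<forall>r. adjacency_eigenvalue G r \<and> \<bar>r\<bar> \<noteq> real k \<longrightarrow> \<bar>r\<bar> \<le> 2 * sqrt (real k - 1))"

definition graph_distance :: "'v pair_pre_digraph \<Rightarrow> 'v \<Rightarrow> 'v \<Rightarrow> ereal" where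
  "graph_distance G x y = wf_digraph.\<mu> (with_proj G) (\<lambda>_. 1) x y"

text \<open>The supremum is finite for connected graphs, the only ones considered.\<close>

definition diam :: "'v pair_pre_digraph \<Rightarrow> real" where
  "diam G = real_of_ereal (SUP x\<in>pverts G. SUP y\<in>pverts G. graph_distance G x y)"

subsection \<open>Continuous-time simple random walk\<close>

text \<open>
  A sample point \<open>(\<tau>, \<xi>)\<close> consists of i.i.d. rate-one exponential holding times \<open>\<tau> n\<close> and,
  independently, of independent uniformly chosen neighbours \<open>\<xi> n x\<close> of every vertex \<open>x\<close>, one for
  each step \<open>n\<close>. The walk sits at its \<open>n\<close>-th position \<open>y\<close> for time \<open>\<tau> n\<close> and then jumps to
  \<open>\<xi> n y\<close>; only one \<open>\<xi> n y\<close> is used for each \<open>n\<close>, so the successive positions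
  form the discrete-time simple random walk.
\<close>

definition walk_space :: "'v pair_pre_digraph \<Rightarrow> ((nat \<Rightarrow> real) \<times> (nat \<Rightarrow> 'v \<Rightarrow> 'v)) measure" where
  "walk_space G =
     (\<Pi>\<^sub>M n\<in>UNIV. density lborel (\<lambda>u. ennreal (exponential_density 1 u))) \<Otimes>\<^sub>M
     (\<Pi>\<^sub>M n\<in>UNIV. \<Pi>\<^sub>M x\<in>pverts G. measure_pmf (pmf_of_set (parcs G `` {x})))"

primrec jump_chain :: "'v \<Rightarrow> (nat \<Rightarrow> 'v \<Rightarrow> 'v) \<Rightarrow> nat \<Rightarrow> 'v" where
  "jump_chain x \<xi> 0 = x"
| "jump_chain x \<xi> (Suc n) = \<xi> n (jump_chain x \<xi> n)"

text \<open>The number of jumps up to and including time \<open>t\<close>.\<close>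

definition jump_count :: "(nat \<Rightarrow> real) \<Rightarrow> real \<Rightarrow> nat" where
  "jump_count \<tau> t = (LEAST n. t < (\<Sum>i\<le>n. \<tau> i))"

text \<open>\<open>walk x t\<close> is the position \<open>X\<^sub>t\<close> of the walk started from \<open>x\<close>.\<close>

definition walk :: "'v \<Rightarrow> real \<Rightarrow> (nat \<Rightarrow> real) \<times> (nat \<Rightarrow> 'v \<Rightarrow> 'v) \<Rightarrow> 'v" where
  "walk x t \<omega> = jump_chain x (snd \<omega>) (jump_count (fst \<omega>) t)"

definition walk_law :: "'v pair_pre_digraph \<Rightarrow> real \<Rightarrow> 'v \<Rightarrow> 'v measure" where
  "walk_law G t x = distr (walk_space G) (count_space UNIV) (walk x t)"

text \<open>\<open>local_time x y t\<close> is \<open>L\<^sub>y(t)\<close> for the walk started from \<open>x\<close>.\<close>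

definition local_time ::
    "'v \<Rightarrow> 'v \<Rightarrow> real \<Rightarrow> (nat \<Rightarrow> real) \<times> (nat \<Rightarrow> 'v \<Rightarrow> 'v) \<Rightarrow> real" where
  "local_time x y t \<omega> = (LINT u:{0..t}|lborel. indicator {y} (walk x u \<omega>))"

definition tv_dist :: "'v measure \<Rightarrow> 'v measure \<Rightarrow> real" where
  "tv_dist P Q = (SUP A\<in>sets P. \<bar>measure P A - measure Q A\<bar>)"

definition mixing_time :: "'v pair_pre_digraph \<Rightarrow> real \<Rightarrow> real" where
  "mixing_time G \<epsilon> =
     Inf {t. 0 \<le> t \<and>
       (SUP x\<in>pverts G. tv_dist (walk_law G t x) (measure_pmf (pmf_of_set (pverts G)))) \<le> \<epsilon>}"

subsection \<open>Families of graphs\<close>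

text \<open>The filter of \<open>m \<rightarrow> \<infinity>\<close> with \<open>m\<close> restricted to the index set \<open>M\<close>.\<close>

abbreviation at_top_along :: "nat set \<Rightarrow> nat filter" where
  "at_top_along M \<equiv> inf at_top (principal M)"

definition strongly_uniformly_transient ::
    "nat set \<Rightarrow> (nat \<Rightarrow> 'v pair_pre_digraph) \<Rightarrow> bool" where
  "strongly_uniformly_transient M \<Gamma> \<longleftrightarrow>
     ((\<lambda>s :: real. Limsup (at_top_along M) (\<lambda>m. ereal
         (MAX x\<in>pverts (\<Gamma> m).
            LINT \<omega>|walk_space (\<Gamma> m).
              local_time x x (mixing_time (\<Gamma> m) (1/4)) \<omega> - local_time x x s \<omega>)))
      \<longlongrightarrow> 0) at_top"

definition diameter_condition :: "nat set \<Rightarrow> (nat \<Rightarrow> 'v pair_pre_digraph) \<Rightarrow> bool" where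
  "diameter_condition M \<Gamma> \<longleftrightarrow>
     ((\<lambda>m. (diam (\<Gamma> m))\<^sup>2 * ln (real (card (pverts (\<Gamma> m)))) / real (card (pverts (\<Gamma> m))))
      \<longlongrightarrow> 0) (at_top_along M)"

end

theory Submission
  imports Defs "HOL-Real_Asymp.Real_Asymp"
begin

text \<open>
  Write \<open>n = m\<^sup>2 h\<close> for the number of vertices and \<open>D = k + 2\<close> for the degree of the product. A point mass
  splits into the waves \<open>cos (2\<pi>j(i - a)/m) / n\<close>, which are eigenfunctions of the generator with rates
  \<open>\<lambda>\<^sub>j = 4 sin\<^sup>2(\<pi>j/m) / D\<close>, plus a remainder that sums to zero on every copy of the Ramanujan graph
  and therefore decays in \<open>L\<^sup>2\<close> at a rate \<open>c > 0\<close> depending on \<open>k\<close> only. Hence the return probability at time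
  \<open>t\<close> is at most \<open>(1 + \<Sum>\<^sub>j exp(-\<lambda>\<^sub>j t)) / n + exp(-c t)\<close>, the sum being over \<open>j \<noteq> 0\<close>. As
  \<open>\<Sum>\<^sub>j 1/\<lambda>\<^sub>j = O(m\<^sup>2)\<close>, the mixing time is of order \<open>m\<^sup>2\<close>, and integrating from \<open>s\<close> to the mixing time
  gives at most \<open>O(m\<^sup>2/n) + exp(-c s)/c\<close> with \<open>m\<^sup>2/n = 1/h \<longrightarrow> 0\<close>. The diameter is at least \<open>m/2\<close>, so
  the quantity in the diameter condition is at least of order \<open>log m / h\<close>.
\<close>

section \<open>The law of the walk\<close>

text \<open>The Ramanujan property is used only as an upper bound for the quadratic form on sum-zero
  functions. In continuous time an eigenvalue \<open>-k\<close> only speeds up the decay, so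
  bipartite factors are harmless. The bound comes from maximising the Rayleigh quotient and the
  decay from a differential inequality, so only the cycle is diagonalised explicitly.

  The remainder starts with \<open>L2\<close> norm at most 1, so its value at a point is at most
  \<open>exp(-c t)\<close> without any volume factor. This makes the tail in \<open>s\<close>
  uniform in \<open>m\<close>. For the mixing time the remainder is needed in \<open>L1\<close>,
  which costs \<open>sqrt n\<close>; since \<open>h <= m\<close> this is at most \<open>m^2\<close>
  and is absorbed by the exponential at times of order \<open>m^2\<close>.

  The mixing time also has to be bounded below: the difference of local times is an integral of
  return probabilities over \<open>[s, t_mix]\<close> only if \<open>s <= t_mix\<close>. The slowest
  wave, as a test function, gives that bound.

  All estimates concern the semigroup, while the walk is given on a concrete sample space; the two
  are linked by the Poisson law of the number of jumps.\<close>

definition neighbour_average :: "'v pair_pre_digraph \<Rightarrow> ('v \<Rightarrow> real) \<Rightarrow> 'v \<Rightarrow> real" where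
  "neighbour_average G f x = (\<Sum>y\<in>parcs G `` {x}. f y) / real (card (parcs G `` {x}))"

text \<open>The semigroup \<open>exp(-t(I - P))\<close> with \<open>P\<close> the neighbour average,
  written as a Poisson mixture of powers of \<open>P\<close>. This is the form in which the walk
  produces it: a Poisson number of jumps followed by that many steps.\<close>

definition heat :: "'v pair_pre_digraph \<Rightarrow> real \<Rightarrow> ('v \<Rightarrow> real) \<Rightarrow> 'v \<Rightarrow> real" where
  "heat G t f x = (\<Sum>n. exp (-t) * t ^ n / fact n * (neighbour_average G ^^ n) f x)"

abbreviation holding_times :: "(nat \<Rightarrow> real) measure" where
  "holding_times \<equiv> (\<Pi>\<^sub>M n\<in>UNIV. density lborel (\<lambda>u. ennreal (exponential_density 1 u)))"

locale finite_walk =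
  fixes G :: "'v pair_pre_digraph"
  assumes finite_verts: "finite (pverts G)"
    and arcs_verts: "parcs G \<subseteq> pverts G \<times> pverts G"
    and has_neighbour: "x \<in> pverts G \<Longrightarrow> parcs G `` {x} \<noteq> {}"
begin

abbreviation "step_choices \<equiv> (\<Pi>\<^sub>M x\<in>pverts G. measure_pmf (pmf_of_set (parcs G `` {x})))"
abbreviation "steps \<equiv> (\<Pi>\<^sub>M n\<in>(UNIV :: nat set). step_choices)"

lemma neighbours_subset: "parcs G `` {x} \<subseteq> pverts G"
  using arcs_verts by auto

lemma finite_neighbours: "finite (parcs G `` {x})"
  using neighbours_subset finite_verts by (rule finite_subset)

lemma prob_space_step_choices: "prob_space step_choices"
  by (intro prob_space_PiM prob_space_measure_pmf)

lemma prob_space_steps: "prob_space steps"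
  by (intro prob_space_PiM prob_space_step_choices)

text \<open>The coordinate read at step \<open>n\<close> depends on the random current position, so
  measurability is checked separately for each of the countably many positions that matter.\<close>

lemma measurable_jump_chain [measurable]:
  "(\<lambda>\<xi>. jump_chain x \<xi> n) \<in> measurable steps (count_space UNIV)"
proof (induction n)
  case 0
  then show ?case by simp
next
  case (Suc n)
  let ?I = "insert None (Some ` pverts G)"
  \<comment> \<open>\<open>None\<close> stands for every position outside the graph: there the
    sample functions are \<open>undefined\<close> by extensionality, so the next position is
    constant.\<close>
  define loc where "loc = (\<lambda>\<xi>. let y = jump_chain x \<xi> n in if y \<in> pverts G then Some y else None)"
  define f where "f = (\<lambda>i (\<xi> :: nat \<Rightarrow> 'v \<Rightarrow> 'v). case i of Some z \<Rightarrow> \<xi> n z | None \<Rightarrow> undefined)"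
  have f: "f i \<in> measurable steps (count_space UNIV)" if "i \<in> ?I" for i
  proof (cases i)
    case None
    then show ?thesis by (simp add: f_def)
  next
    case (Some z)
    with that have "z \<in> pverts G" by auto
    then have "(\<lambda>\<xi>. \<xi> n z) \<in> measurable steps (measure_pmf (pmf_of_set (parcs G `` {z})))"
      by (intro measurable_compose[OF measurable_component_singleton[of n UNIV] measurable_component_singleton]) auto
    then show ?thesis
      using Some by (simp add: f_def)
  qed
  have "loc \<in> measurable steps (count_space ?I)"
    unfolding loc_def by (rule measurable_compose[OF Suc.IH]) (auto simp: Let_def)
  moreover have "countable ?I"
    using finite_verts by (simp add: countable_finite)
  ultimately have "(\<lambda>\<xi>. f (loc \<xi>) \<xi>) \<in> measurable steps (count_space UNIV)"
    using f by (intro measurable_compose_countable'[where f = f and g = loc and I = ?I])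
  also have "?this \<longleftrightarrow> ?case"
  proof (rule measurable_cong)
    fix \<xi> assume "\<xi> \<in> space steps"
    then have "\<xi> n \<in> extensional (pverts G)"
      by (auto simp: space_PiM PiE_def)
    then show "f (loc \<xi>) \<xi> = jump_chain x \<xi> (Suc n)"
      by (auto simp: f_def loc_def Let_def extensional_def)
  qed
  finally show ?case .
qed

lemma jump_chain_case_nat: "jump_chain x (case_nat f \<xi>) (Suc n) = jump_chain (f x) \<xi> n"
  by (induction n) auto

text \<open>Conditioning on the first step: after it, the chain runs from a uniform neighbour of
  \<open>x\<close> with fresh, independent steps, which applies one more neighbour average.\<close>

lemma measure_jump_chain:
  assumes "x \<in> pverts G"
  shows "measure steps {\<xi> \<in> space steps. jump_chain x \<xi> n \<in> B}
    = (neighbour_average G ^^ n) (indicator B) x"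
  using assms
proof (induction n arbitrary: x)
  case 0
  interpret S: prob_space steps by (rule prob_space_steps)
  show ?case
    by (auto simp: S.prob_space indicator_def)
next
  case (Suc n)
  interpret K: prob_space step_choices by (rule prob_space_step_choices)
  interpret S: prob_space steps by (rule prob_space_steps)
  interpret P: product_prob_space "\<lambda>_ :: nat. step_choices" UNIV
    by standard
  interpret Q: sequence_space step_choices ..
  let ?A = "\<lambda>x n. {\<xi> \<in> space steps. jump_chain x \<xi> n \<in> B}"
  have A: "?A x n \<in> sets steps" for x n
    using measurable_sets[OF measurable_jump_chain[of x n], of B]
    by (simp add: vimage_def Int_def conj_commute)
  have nonneg: "0 \<le> (neighbour_average G ^^ n) (indicator B) y" if "y \<in> parcs G `` {x}" for y
  proof -
    from that have "y \<in> pverts G"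
      using neighbours_subset by blast
    from Suc.IH[OF this, symmetric] show ?thesis
      by simp
  qed
  \<comment> \<open>An i.i.d. sequence has the law of a first element put in front of an independent
    copy of the whole sequence.\<close>
  have "emeasure steps (?A x (Suc n))
      = emeasure (distr (step_choices \<Otimes>\<^sub>M steps) steps (\<lambda>(s, \<omega>). case_nat s \<omega>)) (?A x (Suc n))"
    by (simp only: Q.PiM_iter)
  also have "\<dots> = emeasure (step_choices \<Otimes>\<^sub>M steps)
      ((\<lambda>(s, \<omega>). case_nat s \<omega>) -` ?A x (Suc n) \<inter> space (step_choices \<Otimes>\<^sub>M steps))"
    by (rule emeasure_distr[OF _ A]) measurable
  also have "\<dots> = (\<integral>\<^sup>+ f. emeasure steps (Pair f -`
      ((\<lambda>(s, \<omega>). case_nat s \<omega>) -` ?A x (Suc n) \<inter> space (step_choices \<Otimes>\<^sub>M steps))) \<partial>step_choices)"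
    by (rule S.emeasure_pair_measure_alt[OF measurable_sets[OF _ A]]) measurable
  also have "\<dots> = (\<integral>\<^sup>+ f. ennreal (measure steps (?A (f x) n)) \<partial>step_choices)"
  proof (rule nn_integral_cong)
    fix f assume f: "f \<in> space step_choices"
    have "(\<forall>i. case_nat f \<xi> i \<in> X) \<longleftrightarrow> f \<in> X \<and> (\<forall>i. \<xi> i \<in> X)" for X and \<xi> :: "nat \<Rightarrow> 'v \<Rightarrow> 'v"
    proof (intro iffI conjI allI)
      assume all: "\<forall>i. case_nat f \<xi> i \<in> X"
      show "f \<in> X" using spec[OF all, of 0] by simp
      show "\<xi> i \<in> X" for i using spec[OF all, of "Suc i"] by simp
    next
      show "case_nat f \<xi> i \<in> X" if "f \<in> X \<and> (\<forall>i. \<xi> i \<in> X)" for i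
        using that by (cases i) auto
    qed
    then have "case_nat f \<xi> \<in> space steps \<longleftrightarrow> \<xi> \<in> space steps" for \<xi>
      using f by (simp only: space_PiM PiE_UNIV_domain Pi_iff) simp
    then have "Pair f -` ((\<lambda>(s, \<omega>). case_nat s \<omega>) -` ?A x (Suc n) \<inter> space (step_choices \<Otimes>\<^sub>M steps))
      = ?A (f x) n"
      using f by (auto simp: space_pair_measure jump_chain_case_nat simp del: jump_chain.simps)
    then show "emeasure steps (Pair f -` ((\<lambda>(s, \<omega>). case_nat s \<omega>) -` ?A x (Suc n) \<inter> space (step_choices \<Otimes>\<^sub>M steps)))
      = ennreal (measure steps (?A (f x) n))"
      by (simp add: S.emeasure_eq_measure)
  qed
  \<comment> \<open>Of the whole first step function only its value at \<open>x\<close> is used, so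
    its law may be replaced by the marginal at \<open>x\<close>.\<close>
  also have "\<dots> = (\<integral>\<^sup>+ y. ennreal (measure steps (?A y n)) \<partial>measure_pmf (pmf_of_set (parcs G `` {x})))"
    using Suc.prems
    by (subst distr_PiM_component[of "pverts G" "\<lambda>x. measure_pmf (pmf_of_set (parcs G `` {x}))" x, symmetric])
       (auto simp: nn_integral_distr prob_space_measure_pmf)
  also have "\<dots> = (\<Sum>y\<in>parcs G `` {x}. ennreal (measure steps (?A y n))) / card (parcs G `` {x})"
    using has_neighbour[OF Suc.prems] finite_neighbours by (intro nn_integral_pmf_of_set)
  also have "\<dots> = (\<Sum>y\<in>parcs G `` {x}. ennreal ((neighbour_average G ^^ n) (indicator B) y)) / card (parcs G `` {x})"
    by (intro arg_cong2[where f = "(/)"] sum.cong refl arg_cong[where f = ennreal] Suc.IH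
        subsetD[OF neighbours_subset])
  also have "\<dots> = ennreal ((neighbour_average G ^^ Suc n) (indicator B) x)"
  proof -
    have "0 < card (parcs G `` {x})"
      using has_neighbour[OF Suc.prems] finite_neighbours by (simp add: card_gt_0_iff)
    moreover have "0 \<le> sum ((neighbour_average G ^^ n) (indicator B)) (parcs G `` {x})"
      by (intro sum_nonneg nonneg)
    ultimately show ?thesis
      using nonneg by (subst sum_ennreal)
        (simp_all add: neighbour_average_def divide_ennreal ennreal_of_nat_eq_real_of_nat)
  qed
  finally have "ennreal (measure steps (?A x (Suc n))) = ennreal ((neighbour_average G ^^ Suc n) (indicator B) x)"
    by (simp only: S.emeasure_eq_measure)
  moreover have "0 \<le> (neighbour_average G ^^ Suc n) (indicator B) x"
    by (simp only: funpow.simps o_apply neighbour_average_def) (intro divide_nonneg_nonneg sum_nonneg nonneg of_nat_0_le_iff)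
  ultimately show ?case
    by (subst (asm) ennreal_inj) simp_all
qed

end

section \<open>Holding times and the Poisson law of the jump count\<close>

lemma prob_space_holding_times: "prob_space holding_times"
  by (intro prob_space_PiM prob_space_exponential_density) simp

lemma distr_holding_times_component:
  "distr holding_times borel (\<lambda>\<tau>. \<tau> i) = density lborel (\<lambda>u. ennreal (exponential_density 1 u))"
proof -
  let ?E = "density lborel (\<lambda>u. ennreal (exponential_density 1 u))"
  have "distr holding_times borel (\<lambda>\<tau>. \<tau> i) = distr holding_times ?E (\<lambda>\<tau>. \<tau> i)"
    by (rule distr_cong) simp_all
  also have "\<dots> = ?E"
    by (rule distr_PiM_component) (simp_all add: prob_space_exponential_density)
  finally show ?thesis .
qed

lemma sets_holding_times: "sets holding_times = sets (\<Pi>\<^sub>M i\<in>UNIV. borel)"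
  by (rule sets_PiM_cong) simp_all

lemma measurable_holding_time [measurable]: "(\<lambda>\<tau>. \<tau> i) \<in> borel_measurable holding_times"
  by (subst measurable_cong_sets[OF sets_holding_times refl]) measurable

lemma indep_vars_holding_times:
  "prob_space.indep_vars holding_times (\<lambda>_. borel) (\<lambda>i \<tau>. \<tau> i) UNIV"
proof -
  interpret prob_space holding_times by (rule prob_space_holding_times)
  have "distr holding_times (\<Pi>\<^sub>M i\<in>UNIV. borel) (\<lambda>x. \<lambda>i\<in>UNIV. x i) = distr holding_times holding_times (\<lambda>x. x)"
    by (rule distr_cong) (simp_all add: sets_holding_times restrict_UNIV)
  then show ?thesis
    by (subst indep_vars_iff_distr_eq_PiM) (simp_all add: distr_holding_times_component)
qed

text \<open>The sum has \<open>n + 1\<close> terms and is the time of the jump number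
  \<open>n + 1\<close>; \<open>erlang_density\<close> is indexed by the number of terms minus
  one.\<close>

lemma distributed_arrival_time:
  "distributed holding_times lborel (\<lambda>\<tau>. \<Sum>i\<le>n. \<tau> i) (erlang_density n 1)"
proof -
  interpret prob_space holding_times by (rule prob_space_holding_times)
  have "distributed holding_times lborel (\<lambda>\<tau>. \<Sum>i\<in>{..n}. \<tau> i) (erlang_density (card {..n} - 1) 1)"
  proof (rule exponential_distributed_sum)
    show "indep_vars (\<lambda>i. borel) (\<lambda>i \<tau>. \<tau> i) {..n}"
      by (rule indep_vars_subset[OF indep_vars_holding_times]) simp
    have "distr holding_times lborel (\<lambda>\<tau>. \<tau> i) = density lborel (\<lambda>u. ennreal (exponential_density 1 u))" for i
      using distr_holding_times_component[of i] by (simp cong: distr_cong)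
    then show "distributed holding_times lborel (\<lambda>\<tau>. \<tau> i) (exponential_density 1)" for i
      by (auto simp: distributed_def)
  qed auto
  then show ?thesis by simp
qed

text \<open>Joint measurability in time and sample point is what Fubini needs for the local
  time.\<close>

lemma measurable_jump_count:
  "(\<lambda>(u, \<tau>). jump_count \<tau> u) \<in> measurable (borel \<Otimes>\<^sub>M holding_times) (count_space UNIV)"
  unfolding jump_count_def by measurable

lemma measurable_jump_count' [measurable]:
  "(\<lambda>\<tau>. jump_count \<tau> t) \<in> measurable holding_times (count_space UNIV)"
  unfolding jump_count_def by measurable

lemma prob_arrival_time_gt:
  assumes "0 \<le> t"
  shows "measure holding_times {\<tau> \<in> space holding_times. t < (\<Sum>i\<le>n. \<tau> i)} = (\<Sum>j\<le>n. exp (-t) * t ^ j / fact j)"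
proof -
  interpret prob_space holding_times by (rule prob_space_holding_times)
  show ?thesis
    using erlang_distributed_gt[OF distributed_arrival_time _ assms, of n] assms
    by (simp add: erlang_CDF_def mult.commute)
qed

lemma sums_poisson_weights: "(\<lambda>n. exp (-t) * t ^ n / fact n) sums (1 :: real)"
  using sums_mult[OF exp_converges[of t], of "exp (-t)"]
  by (simp add: divide_inverse mult_ac exp_minus)

text \<open>Excludes the two kinds of sample points on which \<open>jump_count\<close> has no
  meaning: negative holding times, and explosion before \<open>t\<close>, where \<open>LEAST\<close>
  ranges over no candidate. Non-explosion holds because its probability dominates every partial sum
  of the Poisson weights, and these tend to 1.\<close>

lemma AE_holding_times:
  assumes "0 \<le> t"
  shows "AE \<tau> in holding_times. (\<forall>i. 0 \<le> \<tau> i) \<and> (\<exists>n. t < (\<Sum>i\<le>n. \<tau> i))"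
proof -
  interpret prob_space holding_times by (rule prob_space_holding_times)
  have nonneg: "AE \<tau> in holding_times. \<forall>i. 0 \<le> \<tau> i"
    unfolding AE_all_countable
  proof
    fix i :: nat
    have "AE u in density lborel (\<lambda>u. ennreal (exponential_density 1 u)). 0 \<le> u"
      by (auto simp: AE_density exponential_density_def)
    then show "AE \<tau> in holding_times. 0 \<le> \<tau> i"
      by (intro AE_PiM_component) (simp_all add: prob_space_exponential_density)
  qed
  let ?A = "{\<tau> \<in> space holding_times. \<exists>n. t < (\<Sum>i\<le>n. \<tau> i)}"
  have "(\<lambda>n. \<Sum>j\<le>n. exp (-t) * t ^ j / fact j) \<longlonglongrightarrow> 1"
    using sums_poisson_weights by (simp add: sums_def_le)
  moreover have "(\<Sum>j\<le>n. exp (-t) * t ^ j / fact j) \<le> prob ?A" for n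
    unfolding prob_arrival_time_gt[OF assms, symmetric] by (rule finite_measure_mono) auto
  ultimately have "1 \<le> prob ?A"
    by - (erule LIMSEQ_le_const2, blast)
  then have "prob ?A = 1"
    by (simp add: antisym)
  then have "AE \<tau> in holding_times. \<exists>n. t < (\<Sum>i\<le>n. \<tau> i)"
    by (subst (asm) prob_Collect_eq_1) simp_all
  with nonneg show ?thesis by eventually_elim auto
qed

text \<open>Nonnegative holding times make the arrival times monotone, so the least index beyond
  \<open>t\<close> decides for all later ones.\<close>

lemma jump_count_le_iff:
  assumes "\<forall>i. 0 \<le> \<tau> i" "\<exists>n. t < (\<Sum>i\<le>n. \<tau> i)"
  shows "jump_count \<tau> t \<le> n \<longleftrightarrow> t < (\<Sum>i\<le>n. \<tau> i)"
proof
  assume le: "jump_count \<tau> t \<le> n"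
  have "t < (\<Sum>i\<le>jump_count \<tau> t. \<tau> i)"
    unfolding jump_count_def by (rule LeastI_ex) (fact assms(2))
  also have "\<dots> \<le> (\<Sum>i\<le>n. \<tau> i)"
    using le assms(1) by (intro sum_mono2) auto
  finally show "t < (\<Sum>i\<le>n. \<tau> i)" .
qed (simp add: jump_count_def Least_le)

lemma prob_jump_count:
  assumes "0 \<le> t"
  shows "measure holding_times {\<tau> \<in> space holding_times. jump_count \<tau> t = n} = exp (-t) * t ^ n / fact n"
proof -
  interpret prob_space holding_times by (rule prob_space_holding_times)
  have le: "prob {\<tau> \<in> space holding_times. jump_count \<tau> t \<le> n} = (\<Sum>j\<le>n. exp (-t) * t ^ j / fact j)" for n
    unfolding prob_arrival_time_gt[OF assms, symmetric]
  proof (rule finite_measure_eq_AE)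
    show "AE \<tau> in holding_times. \<tau> \<in> {\<tau> \<in> space holding_times. jump_count \<tau> t \<le> n} \<longleftrightarrow>
        \<tau> \<in> {\<tau> \<in> space holding_times. t < (\<Sum>i\<le>n. \<tau> i)}"
      using AE_holding_times[OF assms] by eventually_elim (simp add: jump_count_le_iff)
  qed measurable
  show ?thesis
  proof (cases n)
    case 0
    then show ?thesis using le[of 0] by simp
  next
    case (Suc k)
    have "{\<tau> \<in> space holding_times. jump_count \<tau> t = n} =
        {\<tau> \<in> space holding_times. jump_count \<tau> t \<le> n} - {\<tau> \<in> space holding_times. jump_count \<tau> t \<le> k}"
      using Suc by auto
    moreover have "prob ({\<tau> \<in> space holding_times. jump_count \<tau> t \<le> n} - {\<tau> \<in> space holding_times. jump_count \<tau> t \<le> k})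
        = (\<Sum>j\<le>n. exp (-t) * t ^ j / fact j) - (\<Sum>j\<le>k. exp (-t) * t ^ j / fact j)"
      unfolding le[symmetric]
    proof (rule finite_measure_Diff)
      show "{\<tau> \<in> space holding_times. jump_count \<tau> t \<le> k} \<subseteq> {\<tau> \<in> space holding_times. jump_count \<tau> t \<le> n}"
        using Suc by auto
    qed measurable
    moreover have "(\<Sum>j\<le>n. exp (-t) * t ^ j / fact j) - (\<Sum>j\<le>k. exp (-t) * t ^ j / fact j) = exp (-t) * t ^ n / fact n"
      unfolding Suc by (simp only: sum.atMost_Suc add_diff_cancel_left')
    ultimately show ?thesis
      by (simp only:)
  qed
qed

section \<open>Law of the walk and expected local time, from the clock and the jump chain
  together\<close>

context finite_walk
begin

lemma walk_space_eq: "walk_space G = holding_times \<Otimes>\<^sub>M steps"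
  by (simp add: walk_space_def)

lemma prob_space_walk_space: "prob_space (walk_space G)"
  unfolding walk_space_eq
  by (rule prob_space_pair[OF prob_space_holding_times prob_space_steps])

lemma measurable_walk_pair:
  "(\<lambda>(u, \<omega>). walk x u \<omega>) \<in> measurable (borel \<Otimes>\<^sub>M walk_space G) (count_space UNIV)"
proof -
  let ?M = "borel \<Otimes>\<^sub>M (holding_times \<Otimes>\<^sub>M steps)"
  have "(\<lambda>p. (fst p, fst (snd p))) \<in> measurable ?M (borel \<Otimes>\<^sub>M holding_times)"
    by measurable
  from measurable_compose[OF this measurable_jump_count]
  have N: "(\<lambda>p. jump_count (fst (snd p)) (fst p)) \<in> measurable ?M (count_space UNIV)"
    by simp
  have "(\<lambda>p. snd (snd p)) \<in> measurable ?M steps"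
    by (rule measurable_compose[OF measurable_snd measurable_snd])
  from measurable_compose[OF this measurable_jump_chain]
  have J: "(\<lambda>p. jump_chain x (snd (snd p)) n) \<in> measurable ?M (count_space UNIV)" for n .
  have "(\<lambda>p. (\<lambda>n p. jump_chain x (snd (snd p)) n) (jump_count (fst (snd p)) (fst p)) p)
      \<in> measurable ?M (count_space UNIV)"
    by (rule measurable_compose_countable'[where f = "\<lambda>n p. jump_chain x (snd (snd p)) n"
          and g = "\<lambda>p. jump_count (fst (snd p)) (fst p)", OF J N]) simp
  then show ?thesis
    by (simp add: walk_space_eq walk_def case_prod_beta')
qed

lemma measurable_walk: "walk x u \<in> measurable (walk_space G) (count_space UNIV)"
proof -
  have "(\<lambda>\<omega>. (u, \<omega>)) \<in> measurable (walk_space G) (borel \<Otimes>\<^sub>M walk_space G)"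
    by measurable
  from measurable_compose[OF this measurable_walk_pair] show ?thesis by simp
qed

text \<open>The event is split by the number of jumps. Each piece is a rectangle in the product of
  clock and steps, so its probability is a Poisson weight times a probability for the jump
  chain.\<close>

lemma prob_walk:
  assumes "x \<in> pverts G" "0 \<le> t"
  shows "measure (walk_space G) {\<omega> \<in> space (walk_space G). walk x t \<omega> \<in> B} = heat G t (indicator B) x"
proof -
  interpret T: prob_space holding_times by (rule prob_space_holding_times)
  interpret S: prob_space steps by (rule prob_space_steps)
  interpret W: prob_space "holding_times \<Otimes>\<^sub>M steps"
    using prob_space_walk_space by (simp add: walk_space_eq)
  define A where "A n = {\<tau> \<in> space holding_times. jump_count \<tau> t = n} \<times>
    {\<xi> \<in> space steps. jump_chain x \<xi> n \<in> B}" for n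
  have T: "{\<tau> \<in> space holding_times. jump_count \<tau> t = n} \<in> sets holding_times" for n
    using measurable_sets[OF measurable_jump_count'[of t], of "{n}"]
    by (simp add: vimage_def Int_def conj_commute)
  have S: "{\<xi> \<in> space steps. jump_chain x \<xi> n \<in> B} \<in> sets steps" for n
    using measurable_sets[OF measurable_jump_chain[of x n], of B]
    by (simp add: vimage_def Int_def conj_commute)
  have "(\<lambda>n. W.prob (A n)) sums W.prob (\<Union>n. A n)"
    using T S by (intro W.finite_measure_UNION) (auto simp: A_def disjoint_family_on_def)
  moreover have "W.prob (A n) = exp (-t) * t ^ n / fact n * (neighbour_average G ^^ n) (indicator B) x" for n
  proof -
    have "W.prob (A n) = measure holding_times {\<tau> \<in> space holding_times. jump_count \<tau> t = n}
        * measure steps {\<xi> \<in> space steps. jump_chain x \<xi> n \<in> B}"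
      unfolding A_def measure_def using T S
      by (subst S.emeasure_pair_measure_Times) (simp_all add: enn2real_mult)
    then show ?thesis
      by (simp only: prob_jump_count[OF assms(2)] measure_jump_chain[OF assms(1)])
  qed
  moreover have "(\<Union>n. A n) = {\<omega> \<in> space (walk_space G). walk x t \<omega> \<in> B}"
    by (auto simp: A_def walk_space_eq walk_def space_pair_measure)
  ultimately show ?thesis
    by (simp add: heat_def walk_space_eq sums_iff)
qed

lemma measure_walk_law:
  assumes "x \<in> pverts G" "0 \<le> t"
  shows "measure (walk_law G t x) B = heat G t (indicator B) x"
  using prob_walk[OF assms, of B]
  by (simp add: walk_law_def measure_distr[OF measurable_walk] vimage_def Int_def conj_commute)

text \<open>Fubini; the integrand is bounded by 1 and supported on a set of finite measure, since
  the time window is bounded.\<close>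

lemma expectation_local_time:
  assumes "x \<in> pverts G" "0 \<le> t"
  shows "integrable (walk_space G) (local_time x y t)"
    and "(LINT \<omega>|walk_space G. local_time x y t \<omega>) = (LINT u:{0..t}|lborel. heat G u (indicator {y}) x)"
proof -
  interpret W: prob_space "walk_space G" by (rule prob_space_walk_space)
  let ?L = "lborel :: real measure"
  interpret P: pair_sigma_finite "walk_space G" ?L ..
  let ?g = "\<lambda>\<omega> u. indicator {0..t} u * indicator {y} (walk x u \<omega>) :: real"
  have "(\<lambda>p. (snd p, fst p)) \<in> measurable (walk_space G \<Otimes>\<^sub>M ?L) (borel \<Otimes>\<^sub>M walk_space G)"
    by measurable
  from measurable_compose[OF this measurable_walk_pair]
  have "(\<lambda>p. walk x (snd p) (fst p)) \<in> measurable (walk_space G \<Otimes>\<^sub>M ?L) (count_space UNIV)"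
    by simp
  from measurable_compose[OF this, of "indicator {y}" borel]
  have "(\<lambda>p. indicator {y} (walk x (snd p) (fst p)) :: real) \<in> borel_measurable (walk_space G \<Otimes>\<^sub>M ?L)"
    by simp
  then have meas: "case_prod ?g \<in> borel_measurable (walk_space G \<Otimes>\<^sub>M ?L)"
    unfolding case_prod_beta' by measurable
  have int: "integrable (walk_space G \<Otimes>\<^sub>M ?L) (case_prod ?g)"
  proof (rule Bochner_Integration.integrable_bound)
    have "emeasure (walk_space G \<Otimes>\<^sub>M ?L) (space (walk_space G) \<times> {0..t}) < \<infinity>"
      using assms by (subst lborel.emeasure_pair_measure_Times) (auto simp: W.emeasure_space_1)
    then show "integrable (walk_space G \<Otimes>\<^sub>M ?L) (indicator (space (walk_space G) \<times> {0..t}) :: _ \<Rightarrow> real)"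
      by (intro integrable_real_indicator) auto
    show "AE p in walk_space G \<Otimes>\<^sub>M ?L. norm (case_prod ?g p)
        \<le> norm (indicator (space (walk_space G) \<times> {0..t}) p :: real)"
      by (intro AE_I2) (auto simp: indicator_def space_pair_measure)
  qed (fact meas)
  have loc: "local_time x y t \<omega> = (LINT u|?L. ?g \<omega> u)" for \<omega>
    by (simp add: local_time_def set_lebesgue_integral_def)
  show "integrable (walk_space G) (local_time x y t)"
    unfolding loc[abs_def] by (rule P.integrable_fst[OF int])
  have "(LINT \<omega>|walk_space G. local_time x y t \<omega>) = (LINT u|?L. LINT \<omega>|walk_space G. ?g \<omega> u)"
    unfolding loc by (rule P.Fubini_integral[OF int, symmetric])
  also have "\<dots> = (LINT u:{0..t}|lborel. heat G u (indicator {y}) x)"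
    unfolding set_lebesgue_integral_def
  proof (rule Bochner_Integration.integral_cong[OF refl])
    fix u :: real
    have "(LINT \<omega>|walk_space G. indicator {y} (walk x u \<omega>)) = heat G u (indicator {y}) x" if "0 \<le> u"
    proof -
      have "(LINT \<omega>|walk_space G. indicator {y} (walk x u \<omega>) :: real)
          = (LINT \<omega>|walk_space G. indicator {\<omega> \<in> space (walk_space G). walk x u \<omega> \<in> {y}} \<omega>)"
        by (rule Bochner_Integration.integral_cong) (auto simp: indicator_def)
      then show ?thesis
        using prob_walk[OF assms(1) that, of "{y}"] by (simp add: Int_absorb2 subset_eq)
    qed
    then show "(LINT \<omega>|walk_space G. ?g \<omega> u) = indicator {0..t} u *\<^sub>R heat G u (indicator {y}) x"
      by (auto simp: indicator_def)
  qed
  finally show "(LINT \<omega>|walk_space G. local_time x y t \<omega>) = (LINT u:{0..t}|lborel. heat G u (indicator {y}) x)" .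
qed

end

section \<open>The heat semigroup\<close>

lemma neighbour_average_sum:
  "neighbour_average G (\<lambda>x. \<Sum>j\<in>J. c j * f j x) = (\<lambda>x. \<Sum>j\<in>J. c j * neighbour_average G (f j) x)"
proof
  fix x
  have "(\<Sum>y\<in>parcs G `` {x}. \<Sum>j\<in>J. c j * f j y) = (\<Sum>j\<in>J. c j * (\<Sum>y\<in>parcs G `` {x}. f j y))"
    by (subst sum.swap) (simp add: sum_distrib_left)
  then show "neighbour_average G (\<lambda>x. \<Sum>j\<in>J. c j * f j x) x = (\<Sum>j\<in>J. c j * neighbour_average G (f j) x)"
    by (simp add: neighbour_average_def sum_divide_distrib[where A = J])
qed

lemma funpow_neighbour_average_sum:
  "(neighbour_average G ^^ n) (\<lambda>x. \<Sum>j\<in>J. c j * f j x) = (\<lambda>x. \<Sum>j\<in>J. c j * (neighbour_average G ^^ n) (f j) x)"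
  by (induction n) (simp_all add: neighbour_average_sum)

lemma heat_0: "heat G 0 f x = f x"
proof -
  have "(\<lambda>n. exp (- 0) * 0 ^ n / fact n * (neighbour_average G ^^ n) f x) sums
      (\<Sum>n\<in>{0}. exp (- 0) * 0 ^ n / fact n * (neighbour_average G ^^ n) f x)"
    by (rule sums_finite) auto
  then show ?thesis
    by (simp add: heat_def sums_iff)
qed

context finite_walk
begin

lemma neighbour_average_cong:
  "(\<And>y. y \<in> pverts G \<Longrightarrow> f y = g y) \<Longrightarrow> neighbour_average G f x = neighbour_average G g x"
  using neighbours_subset[of x] by (auto simp: neighbour_average_def intro!: arg_cong2[where f = "(/)"] sum.cong)

lemma funpow_neighbour_average_cong:
  assumes "\<And>y. y \<in> pverts G \<Longrightarrow> f y = g y" "x \<in> pverts G"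
  shows "(neighbour_average G ^^ n) f x = (neighbour_average G ^^ n) g x"
  using assms(2)
proof (induction n arbitrary: x)
  case (Suc n)
  then show ?case
    by (simp add: neighbour_average_cong[of "(neighbour_average G ^^ n) f" "(neighbour_average G ^^ n) g"])
qed (simp add: assms(1))

lemma heat_cong:
  assumes "\<And>y. y \<in> pverts G \<Longrightarrow> f y = g y" "x \<in> pverts G"
  shows "heat G t f x = heat G t g x"
  unfolding heat_def using funpow_neighbour_average_cong[OF assms] by simp

lemma abs_neighbour_average_le:
  assumes "\<And>y. y \<in> pverts G \<Longrightarrow> \<bar>f y\<bar> \<le> b" "x \<in> pverts G"
  shows "\<bar>neighbour_average G f x\<bar> \<le> b"
proof -
  have c: "0 < card (parcs G `` {x})"
    using has_neighbour[OF assms(2)] finite_neighbours by (simp add: card_gt_0_iff)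
  have "\<bar>\<Sum>y\<in>parcs G `` {x}. f y\<bar> \<le> (\<Sum>y\<in>parcs G `` {x}. b)"
    by (rule order_trans[OF sum_abs]) (intro sum_mono assms(1) subsetD[OF neighbours_subset])
  then show ?thesis
    using c by (simp add: neighbour_average_def divide_le_eq mult.commute)
qed

lemma abs_funpow_neighbour_average_le:
  assumes "\<And>y. y \<in> pverts G \<Longrightarrow> \<bar>f y\<bar> \<le> b" "x \<in> pverts G"
  shows "\<bar>(neighbour_average G ^^ n) f x\<bar> \<le> b"
  using assms(2) by (induction n arbitrary: x) (auto simp: assms(1) abs_neighbour_average_le)

lemma abs_funpow_neighbour_average_le_sum:
  assumes "x \<in> pverts G"
  shows "\<bar>(neighbour_average G ^^ n) f x\<bar> \<le> (\<Sum>y\<in>pverts G. \<bar>f y\<bar>)"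
  using finite_verts by (intro abs_funpow_neighbour_average_le assms member_le_sum) auto

text \<open>Convergence for all real \<open>t\<close>, negative ones included, allows termwise
  differentiation in the two-sided sense even at \<open>t = 0\<close>.\<close>

lemma summable_power_series:
  assumes "x \<in> pverts G"
  shows "summable (\<lambda>n. (neighbour_average G ^^ n) f x / fact n * t ^ n)"
proof (rule summable_comparison_test)
  let ?b = "\<Sum>y\<in>pverts G. \<bar>f y\<bar>"
  show "\<exists>N. \<forall>n\<ge>N. norm ((neighbour_average G ^^ n) f x / fact n * t ^ n) \<le> ?b * (\<bar>t\<bar> ^ n / fact n)"
    using abs_funpow_neighbour_average_le_sum[OF assms, of _ f]
    by (auto simp: abs_mult power_abs intro!: divide_right_mono mult_right_mono)
  show "summable (\<lambda>n. ?b * (\<bar>t\<bar> ^ n / fact n))"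
    using summable_exp[of "\<bar>t\<bar>"] by (intro summable_mult) (simp add: divide_inverse mult.commute)
qed

lemma heat_eq_power_series:
  "x \<in> pverts G \<Longrightarrow> heat G t f x = exp (-t) * (\<Sum>n. (neighbour_average G ^^ n) f x / fact n * t ^ n)"
  using suminf_mult[OF summable_power_series[of x f t], of "exp (-t)"] by (simp add: heat_def mult_ac)

lemma heat_sums:
  "x \<in> pverts G \<Longrightarrow> (\<lambda>n. exp (-t) * t ^ n / fact n * (neighbour_average G ^^ n) f x) sums heat G t f x"
  using summable_mult[OF summable_power_series[of x f t], of "exp (-t)"]
  by (simp add: heat_def sums_iff mult_ac)

lemma heat_sum:
  assumes "x \<in> pverts G"
  shows "heat G t (\<lambda>x. \<Sum>j\<in>J. c j * f j x) x = (\<Sum>j\<in>J. c j * heat G t (f j) x)"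
proof -
  have "(\<lambda>n. \<Sum>j\<in>J. c j * (exp (-t) * t ^ n / fact n * (neighbour_average G ^^ n) (f j) x))
      sums (\<Sum>j\<in>J. c j * heat G t (f j) x)"
    by (intro sums_sum sums_mult heat_sums assms)
  then show ?thesis
    by (simp add: heat_def funpow_neighbour_average_sum sum_distrib_left mult_ac sums_iff)
qed

lemma heat_add:
  assumes "x \<in> pverts G"
  shows "heat G t (\<lambda>x. f x + g x) x = heat G t f x + heat G t g x"
  using heat_sum[OF assms, of t "\<lambda>_. 1" "\<lambda>b. if b then f else g" UNIV]
  by (simp add: UNIV_bool add.commute)

text \<open>Will be applied with \<open>F\<close> a single copy of the second factor in a
  product.\<close>

lemma sum_heat_eq_0:
  assumes "F \<subseteq> pverts G" "\<And>n. (\<Sum>x\<in>F. (neighbour_average G ^^ n) f x) = 0"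
  shows "(\<Sum>x\<in>F. heat G t f x) = 0"
proof -
  have "(\<lambda>n. \<Sum>x\<in>F. exp (-t) * t ^ n / fact n * (neighbour_average G ^^ n) f x) sums (\<Sum>x\<in>F. heat G t f x)"
    using assms(1) by (intro sums_sum heat_sums) auto
  then show ?thesis
    unfolding sum_distrib_left[symmetric] assms(2) mult_zero_right by (rule sums_unique2) (rule sums_zero)
qed

lemma neighbour_average_heat:
  assumes "x \<in> pverts G"
  shows "neighbour_average G (heat G t f) x = heat G t (neighbour_average G f) x"
proof -
  have "(\<lambda>n. (\<Sum>y\<in>parcs G `` {x}. exp (-t) * t ^ n / fact n * (neighbour_average G ^^ n) f y) / real (card (parcs G `` {x})))
      sums ((\<Sum>y\<in>parcs G `` {x}. heat G t f y) / real (card (parcs G `` {x})))"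
    using neighbours_subset by (intro sums_divide sums_sum heat_sums) blast
  moreover have "(neighbour_average G ^^ n) (neighbour_average G f) = neighbour_average G ((neighbour_average G ^^ n) f)" for n
    by (simp add: funpow_swap1)
  ultimately show ?thesis
    by (simp add: heat_def neighbour_average_def sum_distrib_left sum_divide_distrib mult_ac sums_iff)
qed

lemma heat_eigenfunction:
  assumes "\<And>x. x \<in> pverts G \<Longrightarrow> neighbour_average G f x = r * f x" "x \<in> pverts G"
  shows "heat G t f x = exp (- (1 - r) * t) * f x"
proof -
  have "(neighbour_average G ^^ n) f y = r ^ n * f y" if "y \<in> pverts G" for n y
    using that
  proof (induction n arbitrary: y)
    case (Suc n)
    have "(neighbour_average G ^^ Suc n) f y = neighbour_average G (\<lambda>y. r ^ n * f y) y"
      unfolding funpow.simps o_apply by (rule neighbour_average_cong) (rule Suc.IH)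
    also have "\<dots> = r ^ n * neighbour_average G f y"
      by (simp add: neighbour_average_def sum_distrib_left)
    finally show ?case
      using Suc.prems by (simp add: assms(1))
  qed simp
  then have "heat G t f x = exp (-t) * (\<Sum>n. f x * ((r * t) ^ n / fact n))"
    using assms(2) by (simp add: heat_eq_power_series power_mult_distrib mult_ac)
  also have "(\<Sum>n. f x * ((r * t) ^ n / fact n)) = f x * exp (r * t)"
    using sums_mult[OF exp_converges[of "r * t"], of "f x"] by (simp add: sums_iff divide_inverse mult_ac)
  moreover have "exp (- (1 - r) * t) = exp (-t) * exp (r * t)"
    by (simp add: mult_exp_exp left_diff_distrib)
  ultimately show ?thesis
    by simp
qed

lemma heat_const:
  assumes x: "x \<in> pverts G"
  shows "heat G t (\<lambda>_. c) x = c"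
proof -
  have "neighbour_average G (\<lambda>_. c) y = 1 * c" if "y \<in> pverts G" for y
    using has_neighbour[OF that] finite_neighbours[of y] by (simp add: neighbour_average_def)
  from heat_eigenfunction[OF this x] show ?thesis by simp
qed

text \<open>The heat equation. Differentiating the power series shifts its coefficients by one,
  which replaces \<open>f\<close> by its neighbour average.\<close>

lemma has_real_derivative_heat:
  assumes "x \<in> pverts G"
  shows "((\<lambda>t. heat G t f x) has_real_derivative neighbour_average G (heat G t f) x - heat G t f x) (at t)"
proof -
  let ?c = "\<lambda>n. (neighbour_average G ^^ n) f x / fact n"
  have "((\<lambda>t. \<Sum>n. ?c n * t ^ n) has_real_derivative (\<Sum>n. diffs ?c n * t ^ n)) (at t)"
    by (rule termdiffs_strong_converges_everywhere) (rule summable_power_series[OF assms])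
  moreover have "diffs ?c = (\<lambda>n. (neighbour_average G ^^ n) (neighbour_average G f) x / fact n)"
    by (simp add: diffs_def funpow_swap1 fun_eq_iff del: of_nat_Suc)
  ultimately have "((\<lambda>t. exp (-t) * (\<Sum>n. ?c n * t ^ n)) has_real_derivative
      exp (-t) * (\<Sum>n. (neighbour_average G ^^ n) (neighbour_average G f) x / fact n * t ^ n)
        - exp (-t) * (\<Sum>n. ?c n * t ^ n)) (at t)"
    by (auto intro!: derivative_eq_intros)
  then show ?thesis
    using assms by (simp add: heat_eq_power_series neighbour_average_heat)
qed

text \<open>Gronwall for the squared norm of the heat flow.\<close>

lemma heat_contraction:
  assumes gap: "\<And>t. 0 \<le> t \<Longrightarrow> (\<Sum>x\<in>pverts G. heat G t f x * neighbour_average G (heat G t f) x)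
      \<le> \<rho> * (\<Sum>x\<in>pverts G. (heat G t f x)\<^sup>2)"
    and "0 \<le> t"
  shows "(\<Sum>x\<in>pverts G. (heat G t f x)\<^sup>2) \<le> exp (- 2 * (1 - \<rho>) * t) * (\<Sum>x\<in>pverts G. (f x)\<^sup>2)"
proof -
  let ?E = "\<lambda>t. \<Sum>x\<in>pverts G. (heat G t f x)\<^sup>2"
  let ?B = "\<lambda>t. \<Sum>x\<in>pverts G. heat G t f x * neighbour_average G (heat G t f) x"
  have "exp (2 * (1 - \<rho>) * t) * ?E t \<le> exp (2 * (1 - \<rho>) * 0) * ?E 0"
  proof (rule DERIV_nonpos_imp_nonincreasing[OF assms(2)])
    fix u :: real assume u: "0 \<le> u" "u \<le> t"
    have "((\<lambda>u. ?E u) has_real_derivative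
        (\<Sum>x\<in>pverts G. 2 * heat G u f x * (neighbour_average G (heat G u f) x - heat G u f x))) (at u)"
      by (intro DERIV_sum) (auto intro!: derivative_eq_intros has_real_derivative_heat)
    also have "(\<Sum>x\<in>pverts G. 2 * heat G u f x * (neighbour_average G (heat G u f) x - heat G u f x))
        = 2 * (?B u - ?E u)"
      by (simp add: sum_subtractf[symmetric] sum_distrib_left power2_eq_square algebra_simps)
    finally have dE: "((\<lambda>u. ?E u) has_real_derivative 2 * (?B u - ?E u)) (at u)" .
    have "((\<lambda>u. exp (2 * (1 - \<rho>) * u)) has_real_derivative 2 * (1 - \<rho>) * exp (2 * (1 - \<rho>) * u)) (at u)"
      by (auto intro!: derivative_eq_intros)
    from DERIV_mult[OF this dE]
    have "((\<lambda>u. exp (2 * (1 - \<rho>) * u) * ?E u) has_real_derivative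
        exp (2 * (1 - \<rho>) * u) * (2 * (?B u - \<rho> * ?E u))) (at u)"
      by (rule DERIV_cong) (simp add: algebra_simps)
    moreover have "exp (2 * (1 - \<rho>) * u) * (2 * (?B u - \<rho> * ?E u)) \<le> 0"
      using gap[OF u(1)] by (intro mult_nonneg_nonpos) auto
    ultimately show "\<exists>y. ((\<lambda>u. exp (2 * (1 - \<rho>) * u) * ?E u) has_real_derivative y) (at u) \<and> y \<le> 0"
      by blast
  qed
  then have "exp (- 2 * (1 - \<rho>) * t) * (exp (2 * (1 - \<rho>) * t) * ?E t) \<le> exp (- 2 * (1 - \<rho>) * t) * ?E 0"
    by (intro mult_left_mono) simp_all
  moreover have "exp (- 2 * (1 - \<rho>) * t) * exp (2 * (1 - \<rho>) * t) = 1"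
    by (simp add: mult_exp_exp flip: distrib_right)
  ultimately show ?thesis
    by (simp only: heat_0 mult.assoc[symmetric] mult_1)
qed

end

section \<open>Regular graphs and the spectral gap\<close>

locale regular_sym_graph =
  fixes G :: "'v pair_pre_digraph" and d :: nat
  assumes finite_vertices: "finite (pverts G)"
    and vertices_nonempty: "pverts G \<noteq> {}"
    and arcs_in_vertices: "parcs G \<subseteq> pverts G \<times> pverts G"
    and sym_arcs: "(x, y) \<in> parcs G \<Longrightarrow> (y, x) \<in> parcs G"
    and card_neighbours: "x \<in> pverts G \<Longrightarrow> card (parcs G `` {x}) = d"
    and degree_pos: "0 < d"
begin

sublocale finite_walk G
proof
  fix x assume "x \<in> pverts G"
  then show "parcs G `` {x} \<noteq> {}"
    using card_neighbours[of x] degree_pos by (metis card.empty less_irrefl)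
qed (use finite_vertices vertices_nonempty arcs_in_vertices in auto)

lemma neighbour_average_eq:
  "x \<in> pverts G \<Longrightarrow> neighbour_average G f x = (\<Sum>y\<in>parcs G `` {x}. f y) / d"
  by (simp add: neighbour_average_def card_neighbours)

text \<open>Both sides sum over all arcs, and reversing arcs is a bijection by symmetry.\<close>

lemma sum_neighbours_swap:
  fixes F :: "'v \<Rightarrow> 'v \<Rightarrow> real"
  shows "(\<Sum>x\<in>pverts G. \<Sum>y\<in>parcs G `` {x}. F x y) = (\<Sum>x\<in>pverts G. \<Sum>y\<in>parcs G `` {x}. F y x)"
proof -
  have "(\<Sum>x\<in>pverts G. \<Sum>y\<in>parcs G `` {x}. F x y) = (\<Sum>y\<in>pverts G. \<Sum>x\<in>{x\<in>pverts G. y \<in> parcs G `` {x}}. F x y)"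
  proof -
    have "(\<Sum>x\<in>pverts G. \<Sum>y\<in>parcs G `` {x}. F x y) = (\<Sum>x\<in>pverts G. \<Sum>y\<in>{y\<in>pverts G. y \<in> parcs G `` {x}}. F x y)"
      using arcs_in_vertices by (intro sum.cong refl) auto
    also have "\<dots> = (\<Sum>y\<in>pverts G. \<Sum>x\<in>{x\<in>pverts G. y \<in> parcs G `` {x}}. F x y)"
      by (rule sum.swap_restrict[OF finite_vertices finite_vertices])
    finally show ?thesis .
  qed
  also have "(\<Sum>y\<in>pverts G. \<Sum>x\<in>{x\<in>pverts G. y \<in> parcs G `` {x}}. F x y) = (\<Sum>x\<in>pverts G. \<Sum>y\<in>parcs G `` {x}. F y x)"
    using arcs_in_vertices sym_arcs by (intro sum.cong refl) auto
  finally show ?thesis by simp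
qed

lemma sum_neighbours_fst: "(\<Sum>x\<in>pverts G. \<Sum>y\<in>parcs G `` {x}. f x) = real d * (\<Sum>x\<in>pverts G. f x :: real)"
  by (simp add: card_neighbours sum_distrib_left)

lemma sum_neighbours_snd: "(\<Sum>x\<in>pverts G. \<Sum>y\<in>parcs G `` {x}. f y) = real d * (\<Sum>x\<in>pverts G. f x :: real)"
  unfolding sum_neighbours_swap[of "\<lambda>x y. f y"] by (rule sum_neighbours_fst)

text \<open>Expand the square: by regularity and symmetry both diagonal sums equal \<open>d\<close>
  times the squared norm. The factor 1/2 is there because each edge is counted in both
  directions.\<close>

lemma dirichlet_form:
  "real d * (\<Sum>x\<in>pverts G. (f x)\<^sup>2) - (\<Sum>x\<in>pverts G. f x * (\<Sum>y\<in>parcs G `` {x}. f y))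
    = (\<Sum>x\<in>pverts G. \<Sum>y\<in>parcs G `` {x}. (f x - f y)\<^sup>2) / 2"
proof -
  have prod: "(\<Sum>x\<in>pverts G. \<Sum>y\<in>parcs G `` {x}. 2 * f x * f y)
      = 2 * (\<Sum>x\<in>pverts G. f x * (\<Sum>y\<in>parcs G `` {x}. f y))"
    by (simp add: sum_distrib_left mult.assoc)
  have "(\<Sum>x\<in>pverts G. \<Sum>y\<in>parcs G `` {x}. (f x - f y)\<^sup>2)
      = (\<Sum>x\<in>pverts G. \<Sum>y\<in>parcs G `` {x}. (f x)\<^sup>2) + (\<Sum>x\<in>pverts G. \<Sum>y\<in>parcs G `` {x}. (f y)\<^sup>2)
        - (\<Sum>x\<in>pverts G. \<Sum>y\<in>parcs G `` {x}. 2 * f x * f y)"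
    by (simp only: power2_diff sum.distrib sum_subtractf)
  then show ?thesis
    unfolding sum_neighbours_fst sum_neighbours_snd prod by simp
qed

lemma sum_mult_neighbour_average_le:
  "(\<Sum>x\<in>pverts G. f x * neighbour_average G f x) \<le> (\<Sum>x\<in>pverts G. (f x)\<^sup>2)"
proof -
  have "0 \<le> (\<Sum>x\<in>pverts G. \<Sum>y\<in>parcs G `` {x}. (f x - f y)\<^sup>2)"
    by (intro sum_nonneg) simp
  then have "(\<Sum>x\<in>pverts G. f x * (\<Sum>y\<in>parcs G `` {x}. f y)) \<le> real d * (\<Sum>x\<in>pverts G. (f x)\<^sup>2)"
    using dirichlet_form[of f] by simp
  moreover have "(\<Sum>x\<in>pverts G. f x * neighbour_average G f x) = (\<Sum>x\<in>pverts G. f x * (\<Sum>y\<in>parcs G `` {x}. f y)) / d"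
    by (simp add: neighbour_average_eq sum_divide_distrib[where A = "pverts G"])
  ultimately show ?thesis
    using degree_pos by (simp add: divide_le_eq mult.commute)
qed

lemma sum_neighbour_average: "(\<Sum>x\<in>pverts G. neighbour_average G f x) = (\<Sum>x\<in>pverts G. f x)"
  using degree_pos by (simp add: neighbour_average_eq sum_divide_distrib[symmetric] sum_neighbours_snd)

lemma sum_mult_neighbour_average_commute:
  "(\<Sum>x\<in>pverts G. u x * neighbour_average G v x) = (\<Sum>x\<in>pverts G. v x * neighbour_average G u x)"
proof -
  have "(\<Sum>x\<in>pverts G. \<Sum>y\<in>parcs G `` {x}. u x * v y) = (\<Sum>x\<in>pverts G. \<Sum>y\<in>parcs G `` {x}. u y * v x)"
    by (rule sum_neighbours_swap)
  then have "(\<Sum>x\<in>pverts G. u x * (\<Sum>y\<in>parcs G `` {x}. v y)) / d = (\<Sum>x\<in>pverts G. v x * (\<Sum>y\<in>parcs G `` {x}. u y)) / d"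
    by (simp add: sum_distrib_left mult.commute)
  then show ?thesis
    by (simp add: neighbour_average_eq sum_divide_distrib[where A = "pverts G"])
qed

text \<open>On a regular graph with symmetric arcs the neighbour average is self-adjoint, hence so
  are its powers; testing them on two point masses gives the symmetry of every term of the
  series.\<close>

lemma heat_sym:
  assumes "x \<in> pverts G" "y \<in> pverts G"
  shows "heat G t (indicator {x}) y = heat G t (indicator {y}) x"
proof -
  have "(\<Sum>z\<in>pverts G. u z * (neighbour_average G ^^ n) v z) = (\<Sum>z\<in>pverts G. v z * (neighbour_average G ^^ n) u z)"
    for u v n
  proof (induction n arbitrary: u v)
    case (Suc n)
    have "(\<Sum>z\<in>pverts G. u z * (neighbour_average G ^^ Suc n) v z)
        = (\<Sum>z\<in>pverts G. (neighbour_average G ^^ n) v z * neighbour_average G u z)"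
      by (simp add: sum_mult_neighbour_average_commute[of u])
    also have "\<dots> = (\<Sum>z\<in>pverts G. v z * (neighbour_average G ^^ n) (neighbour_average G u) z)"
      using Suc.IH[of "neighbour_average G u" v] by (simp add: mult.commute)
    finally show ?case
      by (simp add: funpow_swap1)
  qed (simp add: mult.commute)
  from this[of "indicator {y}" _ "indicator {x}"]
  have "(neighbour_average G ^^ n) (indicator {x}) y = (neighbour_average G ^^ n) (indicator {y}) x" for n
    using assms finite_vertices by (simp add: indicator_def if_distrib[of "\<lambda>c. c * _"] cong: if_cong)
  then show ?thesis
    by (simp add: heat_def)
qed

end

section \<open>The spectral gap on sum-zero functions, from compactness of the unit sphere\<close>

lemma compact_function_box:
  fixes S :: "'i \<Rightarrow> real set"
  assumes "\<And>i. compact (S i)"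
  shows "compact {f. \<forall>i. f i \<in> S i}"
proof -
  have "compactin (product_topology (\<lambda>_. euclidean) UNIV) (PiE UNIV S)"
    by (simp add: compactin_PiE assms)
  then show ?thesis
    by (simp add: euclidean_product_topology PiE_UNIV_domain Pi_iff Pi_def)
qed

context regular_sym_graph
begin

text \<open>The maximiser of the Rayleigh quotient on the sum-zero unit sphere is an eigenfunction.\<close>

lemma sum_zero_eigenfunction_exists:
  fixes f0 :: "'v \<Rightarrow> real"
  assumes "(\<Sum>x\<in>pverts G. f0 x) = 0" "\<exists>x\<in>pverts G. f0 x \<noteq> 0"
  obtains g :: "'v \<Rightarrow> real" and \<mu> where "(\<Sum>x\<in>pverts G. g x) = 0" "\<exists>x\<in>pverts G. g x \<noteq> 0"
    "\<And>x. x \<in> pverts G \<Longrightarrow> (\<Sum>y\<in>parcs G `` {x}. g y) = \<mu> * g x"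
    "\<And>f. (\<Sum>x\<in>pverts G. f x) = 0 \<Longrightarrow>
      (\<Sum>x\<in>pverts G. f x * (\<Sum>y\<in>parcs G `` {x}. f y)) \<le> \<mu> * (\<Sum>x\<in>pverts G. (f x)\<^sup>2)"
proof -
  let ?V = "pverts G"
  let ?A = "\<lambda>f x. \<Sum>y\<in>parcs G `` {x}. f y :: real"
  let ?q = "\<lambda>f. \<Sum>x\<in>?V. f x * ?A f x"
  let ?n = "\<lambda>f. \<Sum>x\<in>?V. (f x)\<^sup>2 :: real"
  \<comment> \<open>The sum-zero unit sphere. Pinning the values off the vertex set to 0 and
    bounding the others, which costs nothing for unit vectors, places it inside a compact box of the
    function space with the product topology.\<close>
  define K :: "('v \<Rightarrow> real) set" where
    "K = {f. \<forall>x. f x \<in> (if x \<in> ?V then {-1..1} else {0})} \<inter> ({f. sum f ?V = 0} \<inter> {f. ?n f = 1})"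
  have coord: "continuous_on UNIV (\<lambda>f :: 'v \<Rightarrow> real. f x)" for x
    by (rule continuous_on_product_coordinates)
  have "closed {f :: 'v \<Rightarrow> real. sum f ?V = 0}" "closed {f :: 'v \<Rightarrow> real. ?n f = 1}"
    by (intro closed_Collect_eq continuous_intros coord)+
  then have "compact K"
    unfolding K_def by (intro compact_Int_closed compact_function_box closed_Int) auto
  \<comment> \<open>Homogeneity carries a bound on \<open>K\<close> over to every sum-zero function;
    a function of norm zero vanishes on the vertices.\<close>
  have scale: "?q f \<le> \<mu> * ?n f" if max: "\<And>g. g \<in> K \<Longrightarrow> ?q g \<le> \<mu>" and f: "sum f ?V = 0" for f \<mu>
  proof (cases "?n f = 0")
    case True
    then have "f x = 0" if "x \<in> ?V" for x
      using that finite_vertices by (simp add: sum_nonneg_eq_0_iff)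
    then show ?thesis by simp
  next
    case False
    moreover have "0 \<le> ?n f" by (intro sum_nonneg) simp
    ultimately have pos: "0 < ?n f" by simp
    define c where "c = sqrt (?n f)"
    have c: "0 < c" "c\<^sup>2 = ?n f" using pos by (simp_all add: c_def)
    define g where "g x = (if x \<in> ?V then f x / c else 0)" for x
    have bound: "\<bar>f x\<bar> \<le> c" if "x \<in> ?V" for x
    proof -
      have "(f x)\<^sup>2 \<le> ?n f"
        using that finite_vertices by (intro member_le_sum) auto
      then show ?thesis
        using real_sqrt_le_mono[of "(f x)\<^sup>2"] by (simp add: c_def)
    qed
    have "sum g ?V = 0"
      using f by (simp add: g_def flip: sum_divide_distrib)
    moreover have "?n g = 1"
      using c pos by (simp add: g_def power_divide flip: sum_divide_distrib)
    moreover have "g x \<in> (if x \<in> ?V then {-1..1} else {0})" for x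
      using bound[of x] c(1) by (auto simp: g_def abs_le_iff divide_le_eq le_divide_eq)
    ultimately have "g \<in> K"
      by (simp add: K_def)
    moreover have "?q g = ?q f / ?n f"
    proof -
      have "?A g x = ?A f x / c" for x
        unfolding sum_divide_distrib g_def using neighbours_subset by (intro sum.cong refl) auto
      then have "?q g = (\<Sum>x\<in>?V. (f x * ?A f x) / c\<^sup>2)"
        by (intro sum.cong refl) (simp add: g_def power2_eq_square)
      then show ?thesis
        by (simp only: c(2) flip: sum_divide_distrib)
    qed
    ultimately show ?thesis
      using max[of g] pos by (simp add: divide_le_eq)
  qed
  \<comment> \<open>If \<open>K\<close> were empty, \<open>scale\<close> would apply vacuously with
    every \<mu>; the choice made below would give \<open>?q f0 \<le> ?q f0 - 1\<close>.\<close>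
  have "K \<noteq> {}"
  proof
    assume "K = {}"
    then have "?q f0 \<le> \<mu> * ?n f0" for \<mu>
      using scale[of \<mu> f0] assms(1) by simp
    moreover have "0 < ?n f0"
      using assms(2) finite_vertices by (auto intro!: sum_pos2)
    ultimately show False
      using \<open>\<And>\<mu>. ?q f0 \<le> \<mu> * ?n f0\<close>[of "(?q f0 - 1) / ?n f0"] by simp
  qed
  moreover have "continuous_on K ?q"
    by (rule continuous_on_subset[of UNIV]) (intro continuous_intros coord, simp)
  ultimately obtain g where g: "g \<in> K" "\<And>f. f \<in> K \<Longrightarrow> ?q f \<le> ?q g"
    using continuous_attains_sup[OF \<open>compact K\<close>] by blast
  define \<mu> where "\<mu> = ?q g"
  have max: "?q f \<le> \<mu> * ?n f" if "sum f ?V = 0" for f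
    using scale[OF _ that] g(2) by (simp add: \<mu>_def)
  have g0: "sum g ?V = 0" and g1: "?n g = 1"
    using g(1) by (simp_all add: K_def)
  \<comment> \<open>The residual of the eigenvalue equation. It has sum zero itself, so moving from
    \<open>g\<close> along \<open>-h\<close> stays among the admissible functions and no Lagrange
    multiplier for the constraint appears. To first order the move changes
    \<open>?q - \<mu> ?n\<close> by \<open>2 s ?n h\<close>, so maximality forces
    \<open>?n h = 0\<close>.\<close>
  define h where "h x = \<mu> * g x - ?A g x" for x
  have h0: "sum h ?V = 0"
    by (simp add: h_def sum_subtractf g0 sum_neighbours_snd flip: sum_distrib_left)
  have sym: "(\<Sum>x\<in>?V. g x * ?A h x) = (\<Sum>x\<in>?V. h x * ?A g x)"
    using sum_neighbours_swap[of "\<lambda>x y. g x * h y"] by (simp add: sum_distrib_left mult.commute)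
  have "?n h \<le> 0"
  proof (rule field_le_epsilon)
    fix e :: real assume e: "0 < e"
    \<comment> \<open>\<open>C\<close> dominates the second-order coefficient, and the added 1 keeps
      it positive; the step size \<open>s\<close> is then chosen so that the error
      \<open>s * C\<close> is \<open>2 * e\<close>.\<close>
    define C where "C = \<bar>\<mu> * ?n h - ?q h\<bar> + 1"
    have C: "0 < C" "\<mu> * ?n h - ?q h \<le> C" by (auto simp: C_def)
    define s where "s = 2 * e / C"
    have s: "0 < s" "s * C = 2 * e" using e C by (simp_all add: s_def)
    let ?f = "\<lambda>x. g x - s * h x"
    have "sum ?f ?V = 0"
      using g0 h0 by (simp add: sum_subtractf flip: sum_distrib_left)
    from max[OF this] have le: "?q ?f \<le> \<mu> * ?n ?f" .
    have "?A ?f x = ?A g x - s * ?A h x" for x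
      by (simp add: sum_subtractf sum_distrib_left)
    then have "?q ?f = (\<Sum>x\<in>?V. (g x - s * h x) * (?A g x - s * ?A h x))"
      by simp
    also have "\<dots> = ?q g - s * (\<Sum>x\<in>?V. g x * ?A h x) - s * (\<Sum>x\<in>?V. h x * ?A g x) + s\<^sup>2 * ?q h"
      by (simp add: algebra_simps sum.distrib sum_subtractf sum_distrib_left power2_eq_square)
    finally have q: "?q ?f = \<mu> - 2 * s * (\<Sum>x\<in>?V. h x * ?A g x) + s\<^sup>2 * ?q h"
      by (simp add: sym \<mu>_def)
    have "?n ?f = ?n g - 2 * s * (\<Sum>x\<in>?V. g x * h x) + s\<^sup>2 * ?n h"
      by (simp add: power2_eq_square algebra_simps sum.distrib sum_subtractf sum_distrib_left)
    then have n: "?n ?f = 1 - 2 * s * (\<Sum>x\<in>?V. g x * h x) + s\<^sup>2 * ?n h"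
      by (simp add: g1)
    have "?n h = (\<Sum>x\<in>?V. \<mu> * (g x * h x) - h x * ?A g x)"
      by (intro sum.cong refl) (simp add: h_def power2_eq_square algebra_simps)
    then have nh: "?n h = \<mu> * (\<Sum>x\<in>?V. g x * h x) - (\<Sum>x\<in>?V. h x * ?A g x)"
      by (simp add: sum_subtractf sum_distrib_left)
    have "s * (2 * ?n h) \<le> s * (s * (\<mu> * ?n h - ?q h))"
      using le unfolding q n nh by (simp add: algebra_simps power2_eq_square)
    then have "2 * ?n h \<le> s * (\<mu> * ?n h - ?q h)"
      using s(1) by simp
    also have "\<dots> \<le> s * C"
      using s(1) C(2) by (intro mult_left_mono) auto
    finally show "?n h \<le> 0 + e"
      using s(2) by simp
  qed
  then have "?n h = 0"
    by (intro antisym sum_nonneg) auto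
  then have "h x = 0" if "x \<in> ?V" for x
    using that finite_vertices by (simp add: sum_nonneg_eq_0_iff)
  then have eig: "?A g x = \<mu> * g x" if "x \<in> ?V" for x
    using that by (simp add: h_def)
  have ex: "\<exists>x\<in>?V. g x \<noteq> 0"
    using g1 by (metis (no_types, lifting) power_zero_numeral sum.neutral zero_neq_one)
  show thesis
    using that[of g \<mu>] g0 ex eig max by blast
qed

text \<open>For eigenvalue \<open>d\<close> the Dirichlet form vanishes, so \<open>f\<close> takes
  equal values across every arc and hence along every path.\<close>

lemma constant_if_connected:
  assumes "\<And>x. x \<in> pverts G \<Longrightarrow> (\<Sum>y\<in>parcs G `` {x}. f y) = real d * f x"
    and "strongly_connected (with_proj G)" "x \<in> pverts G" "y \<in> pverts G"
  shows "f x = f y"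
proof -
  have "(\<Sum>x\<in>pverts G. \<Sum>y\<in>parcs G `` {x}. (f x - f y)\<^sup>2) = 0"
    using dirichlet_form[of f] by (simp add: assms(1) sum_distrib_left power2_eq_square mult_ac)
  then have arc: "f u = f v" if "(u, v) \<in> parcs G" for u v
    using that arcs_in_vertices finite_vertices finite_neighbours
    by (auto simp: sum_nonneg_eq_0_iff sum_nonneg)
  have "x \<rightarrow>\<^sup>*\<^bsub>with_proj G\<^esub> y"
    using assms(2-4) by (auto simp: strongly_connected_def)
  then have "(x, y) \<in> rtrancl_on (pverts G) (parcs G)"
    by (simp add: reachable_def)
  then show ?thesis
    by (induction rule: rtrancl_on_induct) (use arc in auto)
qed

text \<open>The largest Rayleigh quotient \<mu> on sum-zero functions is an adjacency eigenvalue. It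
  is not \<open>d\<close>, since by connectedness the eigenfunction would be a nonzero constant. If
  it is \<open>-d\<close>, the bound is trivial by sign; otherwise the Ramanujan inequality
  applies.\<close>

lemma ramanujan_gap:
  assumes "ramanujan d G" "(\<Sum>x\<in>pverts G. f x) = 0"
  shows "(\<Sum>x\<in>pverts G. f x * (\<Sum>y\<in>parcs G `` {x}. f y)) \<le> 2 * sqrt (real d - 1) * (\<Sum>x\<in>pverts G. (f x)\<^sup>2)"
proof (cases "\<exists>x\<in>pverts G. f x \<noteq> 0")
  case False
  then show ?thesis by simp
next
  case True
  show ?thesis
  proof (rule sum_zero_eigenfunction_exists[OF assms(2) True])
    fix g :: "'v \<Rightarrow> real" and \<mu>
    assume g: "(\<Sum>x\<in>pverts G. g x) = 0" "\<exists>x\<in>pverts G. g x \<noteq> 0"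
      and eig: "\<And>x. x \<in> pverts G \<Longrightarrow> (\<Sum>y\<in>parcs G `` {x}. g y) = \<mu> * g x"
      and max: "\<And>f. (\<Sum>x\<in>pverts G. f x) = 0 \<Longrightarrow>
        (\<Sum>x\<in>pverts G. f x * (\<Sum>y\<in>parcs G `` {x}. f y)) \<le> \<mu> * (\<Sum>x\<in>pverts G. (f x)\<^sup>2)"
    have "(\<Sum>y\<in>pverts G. adjacency_matrix G x y * g y) = (\<Sum>y\<in>parcs G `` {x}. g y)" for x
    proof -
      have "(\<Sum>y\<in>pverts G. adjacency_matrix G x y * g y) = (\<Sum>y\<in>pverts G. if (x, y) \<in> parcs G then g y else 0)"
        by (intro sum.cong) (auto simp: adjacency_matrix_def)
      also have "\<dots> = (\<Sum>y\<in>parcs G `` {x}. g y)"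
        using finite_vertices arcs_in_vertices by (subst sum.inter_filter[symmetric]) (auto intro!: sum.cong)
      finally show ?thesis .
    qed
    then have eigenvalue: "adjacency_eigenvalue G \<mu>"
      using g(2) eig by (auto simp: adjacency_eigenvalue_def)
    have "\<mu> \<noteq> real d"
    proof
      assume "\<mu> = real d"
      interpret pair_graph G
        using assms(1) by (simp add: ramanujan_def)
      have "strongly_connected (with_proj G)"
        using assms(1) pair_sym_arcs symmetric_connected_imp_strongly_connected by (simp add: ramanujan_def)
      then have const: "g x = g y" if "x \<in> pverts G" "y \<in> pverts G" for x y
        using constant_if_connected[of g x y] eig that \<open>\<mu> = real d\<close> by simp
      from g(2) obtain z where z: "z \<in> pverts G" "g z \<noteq> 0" by blast
      have "(\<Sum>x\<in>pverts G. g x) = real (card (pverts G)) * g z"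
        using const[OF _ z(1)] by simp
      then show False
        using g(1) z finite_vertices by (auto simp: card_eq_0_iff)
    qed
    have "\<mu> \<le> 2 * sqrt (real d - 1)"
    proof (cases "\<bar>\<mu>\<bar> = real d")
      case True
      with \<open>\<mu> \<noteq> real d\<close> have "\<mu> \<le> 0" by linarith
      also have "0 \<le> 2 * sqrt (real d - 1)"
        using degree_pos by simp
      finally show ?thesis .
    next
      case False
      then have "\<bar>\<mu>\<bar> \<le> 2 * sqrt (real d - 1)"
        using assms(1) eigenvalue by (simp add: ramanujan_def)
      then show ?thesis by simp
    qed
    then show ?thesis
      using max[OF assms(2)] by (meson mult_right_mono order_trans sum_nonneg zero_le_power2)
  qed
qed

end

section \<open>Cartesian products\<close>

lemma cartesian_product_neighbours:
  assumes "a \<in> pverts G" "x \<in> pverts H"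
  shows "parcs (cartesian_product G H) `` {(a, x)} = (\<lambda>b. (b, x)) ` (parcs G `` {a}) \<union> Pair a ` (parcs H `` {x})"
  using assms by (auto simp: cartesian_product_def)

lemma pverts_cartesian_product: "pverts (cartesian_product G H) = pverts G \<times> pverts H"
  by (simp add: cartesian_product_def)

text \<open>A vertex could be a neighbour in both directions at once only through loops in both
  factors. Excluding loops in the first keeps the two neighbour sets disjoint and makes the degree
  exactly \<open>d + k\<close>.\<close>

locale cartesian_product_graph =
  G: regular_sym_graph G d + H: regular_sym_graph H k
  for G :: "'v pair_pre_digraph" and d and H :: "'w pair_pre_digraph" and k +
  assumes irrefl: "(a, a) \<notin> parcs G"
begin

abbreviation "\<Gamma> \<equiv> cartesian_product G H"

lemma sum_neighbours:
  assumes "a \<in> pverts G" "x \<in> pverts H"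
  shows "(\<Sum>p\<in>parcs \<Gamma> `` {(a, x)}. f p) = (\<Sum>b\<in>parcs G `` {a}. f (b, x)) + (\<Sum>y\<in>parcs H `` {x}. f (a, y))"
proof -
  have "(\<lambda>b. (b, x)) ` (parcs G `` {a}) \<inter> Pair a ` (parcs H `` {x}) = {}"
    using irrefl by auto
  then show ?thesis
    unfolding cartesian_product_neighbours[OF assms]
    by (subst sum.union_disjoint)
       (simp_all add: G.finite_neighbours H.finite_neighbours sum.reindex inj_on_def)
qed

sublocale regular_sym_graph \<Gamma> "d + k"
proof
  fix p assume p: "p \<in> pverts \<Gamma>"
  then obtain a x where [simp]: "p = (a, x)" and ax: "a \<in> pverts G" "x \<in> pverts H"
    by (auto simp: pverts_cartesian_product)
  have "(\<Sum>p\<in>parcs \<Gamma> `` {(a, x)}. 1 :: nat) = d + k"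
    unfolding sum_neighbours[OF ax] using ax by (simp add: G.card_neighbours H.card_neighbours)
  then show "card (parcs \<Gamma> `` {p}) = d + k" by simp
next
  show "(x, y) \<in> parcs \<Gamma> \<Longrightarrow> (y, x) \<in> parcs \<Gamma>" for x y
    using G.sym_arcs H.sym_arcs by (auto simp: cartesian_product_def)
qed (use G.finite_vertices G.vertices_nonempty G.arcs_in_vertices G.degree_pos
    H.finite_vertices H.vertices_nonempty H.arcs_in_vertices in \<open>auto simp: cartesian_product_def\<close>)

lemma neighbour_average_product:
  assumes "a \<in> pverts G" "x \<in> pverts H"
  shows "neighbour_average \<Gamma> f (a, x) =
    (d * neighbour_average G (\<lambda>b. f (b, x)) a + k * neighbour_average H (\<lambda>y. f (a, y)) x) / (d + k)"
  using assms G.degree_pos H.degree_pos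
  by (subst neighbour_average_eq)
     (simp_all add: pverts_cartesian_product sum_neighbours G.neighbour_average_eq H.neighbour_average_eq)

text \<open>Averaging along \<open>G\<close> averages the fibre sums, which are all zero, and
  averaging along \<open>H\<close> leaves each fibre sum unchanged.\<close>

lemma fibre_sum_neighbour_average:
  assumes "\<And>a. a \<in> pverts G \<Longrightarrow> (\<Sum>x\<in>pverts H. f (a, x)) = 0" "a \<in> pverts G"
  shows "(\<Sum>x\<in>pverts H. neighbour_average \<Gamma> f (a, x)) = 0"
proof -
  have "(\<Sum>x\<in>pverts H. neighbour_average G (\<lambda>b. f (b, x)) a) = (\<Sum>b\<in>parcs G `` {a}. \<Sum>x\<in>pverts H. f (b, x)) / d"
    using assms(2) by (subst sum.swap) (simp add: G.neighbour_average_eq flip: sum_divide_distrib)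
  also have "\<dots> = 0"
    using assms(1) G.arcs_in_vertices by (subst sum.neutral) auto
  finally have "(\<Sum>x\<in>pverts H. neighbour_average G (\<lambda>b. f (b, x)) a) = 0" .
  then show ?thesis
    using assms
    by (simp add: neighbour_average_product H.sum_neighbour_average sum.distrib
        flip: sum_divide_distrib sum_distrib_left)
qed

lemma fibre_sum_heat:
  assumes "\<And>a. a \<in> pverts G \<Longrightarrow> (\<Sum>x\<in>pverts H. f (a, x)) = 0" "a \<in> pverts G"
  shows "(\<Sum>x\<in>pverts H. heat \<Gamma> t f (a, x)) = 0"
proof -
  have "(\<Sum>x\<in>pverts H. (neighbour_average \<Gamma> ^^ n) f (a, x)) = 0" for n
    using assms(2) by (induction n arbitrary: a) (simp_all add: assms(1) fibre_sum_neighbour_average)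
  moreover have "(\<Sum>x\<in>pverts H. g (a, x)) = (\<Sum>p\<in>Pair a ` pverts H. g p)" for g :: "_ \<Rightarrow> real"
    by (simp add: sum.reindex inj_on_def)
  ultimately show ?thesis
    using assms(2) sum_heat_eq_0[of "Pair a ` pverts H" f t] by (auto simp: pverts_cartesian_product)
qed

text \<open>Moves along \<open>G\<close> get only the trivial bound by the squared norm; all of the
  gain comes from \<open>H\<close>, one fibre at a time. Weighting by the degrees gives the
  constant.\<close>

lemma fibre_gap:
  fixes \<rho> :: real
  assumes gap: "\<And>f. (\<Sum>x\<in>pverts H. f x) = 0 \<Longrightarrow>
      (\<Sum>x\<in>pverts H. f x * (\<Sum>y\<in>parcs H `` {x}. f y)) \<le> \<rho> * (\<Sum>x\<in>pverts H. (f x)\<^sup>2)"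
    and f: "\<And>a. a \<in> pverts G \<Longrightarrow> (\<Sum>x\<in>pverts H. f (a, x)) = 0"
  shows "(\<Sum>p\<in>pverts \<Gamma>. f p * neighbour_average \<Gamma> f p) \<le> (d + \<rho>) / (d + k) * (\<Sum>p\<in>pverts \<Gamma>. (f p)\<^sup>2)"
proof -
  let ?E = "\<Sum>a\<in>pverts G. \<Sum>x\<in>pverts H. (f (a, x))\<^sup>2"
  have "(\<Sum>a\<in>pverts G. \<Sum>x\<in>pverts H. f (a, x) * neighbour_average G (\<lambda>b. f (b, x)) a) \<le> ?E"
    unfolding sum.swap[of _ "pverts H" "pverts G"] by (intro sum_mono G.sum_mult_neighbour_average_le)
  then have 1: "d * (\<Sum>a\<in>pverts G. \<Sum>x\<in>pverts H. f (a, x) * neighbour_average G (\<lambda>b. f (b, x)) a) \<le> d * ?E"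
    by (rule mult_left_mono) simp
  have "k * (\<Sum>a\<in>pverts G. \<Sum>x\<in>pverts H. f (a, x) * neighbour_average H (\<lambda>y. f (a, y)) x)
      = (\<Sum>a\<in>pverts G. \<Sum>x\<in>pverts H. f (a, x) * (\<Sum>y\<in>parcs H `` {x}. f (a, y)))"
    using H.degree_pos by (simp add: H.neighbour_average_eq sum_distrib_left[of "real k"])
  also have "\<dots> \<le> (\<Sum>a\<in>pverts G. \<rho> * (\<Sum>x\<in>pverts H. (f (a, x))\<^sup>2))"
    by (intro sum_mono gap f)
  finally have 2: "k * (\<Sum>a\<in>pverts G. \<Sum>x\<in>pverts H. f (a, x) * neighbour_average H (\<lambda>y. f (a, y)) x) \<le> \<rho> * ?E"
    by (simp add: sum_distrib_left)
  have "(\<Sum>p\<in>pverts \<Gamma>. f p * neighbour_average \<Gamma> f p)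
      = (\<Sum>a\<in>pverts G. \<Sum>x\<in>pverts H. (d * (f (a, x) * neighbour_average G (\<lambda>b. f (b, x)) a)
          + k * (f (a, x) * neighbour_average H (\<lambda>y. f (a, y)) x)) / (d + k))"
    unfolding pverts_cartesian_product sum.cartesian_product'
    by (intro sum.cong refl) (simp add: neighbour_average_product algebra_simps)
  also have "\<dots> = (d * (\<Sum>a\<in>pverts G. \<Sum>x\<in>pverts H. f (a, x) * neighbour_average G (\<lambda>b. f (b, x)) a)
      + k * (\<Sum>a\<in>pverts G. \<Sum>x\<in>pverts H. f (a, x) * neighbour_average H (\<lambda>y. f (a, y)) x)) / (d + k)"
    by (simp only: sum.distrib flip: sum_divide_distrib sum_distrib_left)
  also have "\<dots> \<le> (d * ?E + \<rho> * ?E) / (d + k)"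
    by (intro divide_right_mono add_mono 1 2) simp
  also have "\<dots> = (d + \<rho>) / (d + k) * (\<Sum>p\<in>pverts \<Gamma>. (f p)\<^sup>2)"
    unfolding pverts_cartesian_product sum.cartesian_product' by (simp add: algebra_simps)
  finally show ?thesis .
qed

text \<open>The flow keeps all fibre sums at zero, so the gap is available at every time, as the
  differential inequality demands.\<close>

lemma fibre_heat_contraction:
  fixes \<rho> :: real
  assumes gap: "\<And>f. (\<Sum>x\<in>pverts H. f x) = 0 \<Longrightarrow>
      (\<Sum>x\<in>pverts H. f x * (\<Sum>y\<in>parcs H `` {x}. f y)) \<le> \<rho> * (\<Sum>x\<in>pverts H. (f x)\<^sup>2)"
    and f: "\<And>a. a \<in> pverts G \<Longrightarrow> (\<Sum>x\<in>pverts H. f (a, x)) = 0"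
    and "0 \<le> t"
  shows "(\<Sum>p\<in>pverts \<Gamma>. (heat \<Gamma> t f p)\<^sup>2) \<le> exp (- 2 * ((k - \<rho>) / (d + k)) * t) * (\<Sum>p\<in>pverts \<Gamma>. (f p)\<^sup>2)"
proof -
  have "1 - (d + \<rho>) / (d + k) = (k - \<rho>) / (d + k)"
    using G.degree_pos H.degree_pos by (simp add: field_simps add_pos_pos)
  then show ?thesis
    using heat_contraction[OF fibre_gap[OF gap fibre_sum_heat[OF f]] assms(3)] by simp
qed

end

section \<open>The cycle\<close>

text \<open>The predecessor is written with \<open>i + (m - 1)\<close> to avoid truncated
  subtraction at \<open>i = 0\<close>. For \<open>m = 2\<close> both neighbours would
  coincide.\<close>

lemma cycle_graph_neighbours:
  assumes "3 \<le> m" "i < m"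
  shows "parcs (cycle_graph m) `` {i} = {(i + 1) mod m, (i + (m - 1)) mod m}"
    and "(i + 1) mod m \<noteq> (i + (m - 1)) mod m"
proof -
  have pred: "i = (j + 1) mod m \<longleftrightarrow> j = (i + (m - 1)) mod m" if "j < m" for j
    using that assms by (cases "j + 1 = m"; cases i) (auto simp: mod_if)
  show "parcs (cycle_graph m) `` {i} = {(i + 1) mod m, (i + (m - 1)) mod m}"
    using assms pred by (auto simp: cycle_graph_def)
  show "(i + 1) mod m \<noteq> (i + (m - 1)) mod m"
    using assms by (cases "i + 1 = m"; cases i) (auto simp: mod_if)
qed

lemma regular_sym_graph_cycle: "3 \<le> m \<Longrightarrow> regular_sym_graph (cycle_graph m) 2"
proof
  fix i assume "3 \<le> m" "i \<in> pverts (cycle_graph m)"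
  then show "card (parcs (cycle_graph m) `` {i}) = 2"
    using cycle_graph_neighbours[of m i] by (simp add: cycle_graph_def)
qed (auto simp: cycle_graph_def lessThan_empty_iff)

lemma cycle_graph_irrefl: "2 \<le> m \<Longrightarrow> (i, i) \<notin> parcs (cycle_graph m)"
  by (auto simp: cycle_graph_def mod_if)

lemma cos_add_int_2pi: "cos (y + 2 * pi * of_int k) = cos y"
  by (simp add: cos_add sin_int_2pin cos_int_2pin)

lemma cos_mod:
  assumes "0 < m"
  shows "cos (2 * pi * real j * (real (a mod m) - c) / m) = cos (2 * pi * real j * (real a - c) / m)"
proof -
  have "real a = real m * real (a div m) + real (a mod m)"
    by (metis mult_div_mod_eq of_nat_add of_nat_mult)
  then have "2 * pi * real j * (real a - c) / m = 2 * pi * real j * (real (a mod m) - c) / m + 2 * pi * of_int (int (j * (a div m)))"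
    using assms by (simp add: field_simps)
  then show ?thesis
    by (simp only: cos_add_int_2pi)
qed

text \<open>The neighbours have phases \<phi> + \<theta> and \<phi> - \<theta> up to multiples of
  2\<pi>, and the sum of the two cosines is \<open>2 cos \<theta> cos \<phi>\<close>.\<close>

lemma neighbour_average_cycle:
  assumes "3 \<le> m" "i < m"
  shows "neighbour_average (cycle_graph m) (\<lambda>i. cos (2 * pi * real j * (real i - c) / m)) i
    = cos (2 * pi * j / m) * cos (2 * pi * real j * (real i - c) / m)"
proof -
  let ?\<theta> = "2 * pi * j / m" and ?\<phi> = "2 * pi * real j * (real i - c) / m"
  have m: "0 < m" using assms by simp
  have "2 * pi * real j * (real (i + (m - 1)) - c) / m = (?\<phi> - ?\<theta>) + 2 * pi * of_int (int j)"
    using assms by (simp add: field_simps of_nat_diff)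
  then have "cos (2 * pi * real j * (real ((i + (m - 1)) mod m) - c) / m) = cos (?\<phi> - ?\<theta>)"
    by (simp only: cos_mod[OF m] cos_add_int_2pi)
  moreover have "cos (2 * pi * real j * (real ((i + 1) mod m) - c) / m) = cos (?\<phi> + ?\<theta>)"
    unfolding cos_mod[OF m] by (simp add: add_divide_distrib[symmetric] algebra_simps)
  ultimately show ?thesis
    using cycle_graph_neighbours[OF assms]
    by (simp add: neighbour_average_def cos_add cos_diff)
qed

text \<open>Real part of a geometric sum over powers of an \<open>m\<close>-th root of unity, which
  differs from 1 unless \<open>i\<close> and \<open>a\<close> agree modulo \<open>m\<close>.\<close>

lemma sum_cos_multiples:
  fixes m :: nat and a i :: nat
  assumes "i < m" "a < m"
  shows "(\<Sum>j<m. cos (2 * pi * real j * (real i - real a) / m)) = (if i = a then real m else 0)"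
proof (cases "i = a")
  case False
  define z where "z = cis (2 * pi * (real i - real a) / m)"
  have m: "0 < m" using assms by simp
  have pow: "z ^ j = cis (2 * pi * real j * (real i - real a) / m)" for j
    unfolding z_def by (subst Complex.DeMoivre) (rule arg_cong[where f = cis], simp)
  have "z ^ m = cis (2 * pi * of_int (int i - int a))"
    unfolding pow by (rule arg_cong[where f = cis]) (use m in simp)
  also have "\<dots> = 1"
    by (rule cis_multiple_2pi) simp
  finally have "z ^ m = 1" .
  have "z \<noteq> 1"
  proof
    assume "z = 1"
    then have "cos (2 * pi * (real i - real a) / m) = 1"
      by (simp add: z_def complex_eq_iff)
    then obtain n :: int where "2 * pi * (real i - real a) / m = of_int n * 2 * pi"
      by (auto simp: cos_one_2pi_int)
    then have "2 * pi * ((real i - real a) / m) = 2 * pi * of_int n"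
      by simp
    then have "(real i - real a) / m = of_int n"
      by (rule mult_left_cancel[THEN iffD1, rotated]) simp
    then have "real_of_int (int i - int a) = real_of_int (n * int m)"
      using m by (simp add: field_simps)
    then have n: "int i - int a = n * int m"
      by (simp only: of_int_eq_iff)
    then have "int m dvd int i - int a" by simp
    then have "int i mod int m = int a mod int m"
      by (simp add: mod_eq_dvd_iff)
    with assms False show False by simp
  qed
  then have "(\<Sum>j<m. z ^ j) = 0"
    using \<open>z ^ m = 1\<close> by (simp add: geometric_sum)
  then have "Re (\<Sum>j<m. z ^ j) = 0" by simp
  then show ?thesis
    using False by (simp add: pow)
qed simp

definition cycle_rate :: "nat \<Rightarrow> real \<Rightarrow> nat \<Rightarrow> real" where
  "cycle_rate m D j = 4 * (sin (pi * j / m))\<^sup>2 / D"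

text \<open>On the first half, concavity puts the sine above its chord \<open>2 x\<close>;
  reflection treats the second half. The product form covers both ends at once, matching the
  symmetry between \<open>j\<close> and \<open>m - j\<close>.\<close>

lemma sin_pi_mult_ge:
  assumes "0 \<le> x" "x \<le> 1"
  shows "2 * x * (1 - x) \<le> sin (pi * x)"
proof -
  have half: "2 * y \<le> sin (pi * y)" if "0 \<le> y" "y \<le> 1/2" for y
  proof -
    have "convex_on {0..pi} (\<lambda>x. - sin x)"
      by (rule f''_ge0_imp_convex[where f' = "\<lambda>x. - cos x" and f'' = sin])
         (auto intro!: derivative_eq_intros sin_ge_zero)
    then have "- sin ((1 - 2 * y) *\<^sub>R 0 + (2 * y) *\<^sub>R (pi / 2)) \<le> (1 - 2 * y) * - sin 0 + (2 * y) * - sin (pi / 2)"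
      using that by (intro convex_onD) (auto simp: pi_ge_zero)
    then show ?thesis by (simp add: mult.commute)
  qed
  show ?thesis
  proof (cases "x \<le> 1/2")
    case True
    have "2 * x * (1 - x) \<le> 2 * x * 1"
      using assms by (intro mult_left_mono) auto
    then show ?thesis using half[of x] assms True by simp
  next
    case False
    have "2 * x * (1 - x) \<le> 2 * 1 * (1 - x)"
      using assms by (intro mult_right_mono) auto
    also have "2 * 1 * (1 - x) \<le> sin (pi * (1 - x))"
      using half[of "1 - x"] assms False by simp
    also have "\<dots> = sin (pi * x)"
      by (simp add: right_diff_distrib)
    finally show ?thesis .
  qed
qed

lemma sum_inverse_squares_le: "(\<Sum>j=1..n. 1 / (real j)\<^sup>2) \<le> 2"
proof -
  \<comment> \<open>Strengthened so that the induction telescopes.\<close>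
  have "(\<Sum>j=1..n. 1 / (real j)\<^sup>2) \<le> 2 - 1 / n" if "0 < n"
    using that
  proof (induction n)
    case (Suc n)
    show ?case
    proof (cases "n = 0")
      case False
      have "1 / (real (Suc n))\<^sup>2 \<le> 1 / n - 1 / Suc n"
        using False by (simp add: divide_simps power2_eq_square)
      then show ?thesis
        using Suc.IH False by simp
    qed simp
  qed simp
  then show ?thesis
    by (cases "n = 0") (auto intro: order_trans)
qed

lemma cycle_rate_pos:
  assumes "0 < j" "j < m" "0 < D"
  shows "0 < cycle_rate m D j"
proof -
  have "0 < sin (pi * j / m)"
    using assms by (intro sin_gt_zero) (auto simp: divide_simps)
  then show ?thesis
    using assms by (simp add: cycle_rate_def)
qed

text \<open>The sine bound yields inverse rates at most a multiple of
  \<open>(m / (j (m - j)))^2 m^2\<close>. Partial fractions turn this into inverse squares of the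
  distances to both ends, whose sums are at most 2 each.\<close>

lemma sum_inverse_cycle_rate_le:
  assumes "0 < D"
  shows "(\<Sum>j=1..<m. 1 / cycle_rate m D j) \<le> D * (real m)\<^sup>2 / 2"
proof -
  have "1 / cycle_rate m D j \<le> D * (real m)\<^sup>2 / 8 * (1 / (real j)\<^sup>2 + 1 / (real (m - j))\<^sup>2)" if "j \<in> {1..<m}" for j
  proof -
    have j: "0 < real j" "0 < real (m - j)" "real m = real j + real (m - j)"
      using that by (simp_all add: of_nat_diff)
    define x y where "x = real j" and "y = real (m - j)"
    have xy: "0 < x" "0 < y" "real m = x + y" unfolding x_def y_def by (rule j)+
    have "2 * (x / (x + y)) * (1 - x / (x + y)) \<le> sin (pi * (x / (x + y)))"
      using xy by (intro sin_pi_mult_ge) auto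
    also have "1 - x / (x + y) = y / (x + y)"
      using xy by (simp add: field_simps)
    finally have s: "2 * x * y / (x + y)\<^sup>2 \<le> sin (pi * j / m)"
      using xy by (simp add: power2_eq_square x_def[symmetric])
    have "0 < 2 * x * y / (x + y)\<^sup>2"
      using xy by simp
    then have "4 * (2 * x * y / (x + y)\<^sup>2)\<^sup>2 / D \<le> cycle_rate m D j"
      unfolding cycle_rate_def using s assms by (intro divide_right_mono mult_left_mono power_mono) auto
    then have "1 / cycle_rate m D j \<le> 1 / (4 * (2 * x * y / (x + y)\<^sup>2)\<^sup>2 / D)"
      using xy assms by (intro frac_le) simp_all
    \<comment> \<open>Uses \<open>(x + y) / (x y) = 1/x + 1/y\<close>.\<close>
    also have "\<dots> = D * (x + y)\<^sup>2 / 16 * (1 / x + 1 / y)\<^sup>2"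
      using xy assms by (simp add: field_simps power2_eq_square)
    also have "\<dots> \<le> D * (x + y)\<^sup>2 / 16 * (2 * (1 / x\<^sup>2 + 1 / y\<^sup>2))"
    proof (rule mult_left_mono)
      have "0 \<le> (1 / x - 1 / y)\<^sup>2" by simp
      then show "(1 / x + 1 / y)\<^sup>2 \<le> 2 * (1 / x\<^sup>2 + 1 / y\<^sup>2)"
        by (simp add: power2_diff power2_sum power_divide)
      show "0 \<le> D * (x + y)\<^sup>2 / 16"
        using assms by simp
    qed
    also have "\<dots> = D * (x + y)\<^sup>2 / 8 * (1 / x\<^sup>2 + 1 / y\<^sup>2)"
      by simp
    finally show ?thesis
      unfolding x_def[symmetric] y_def[symmetric] xy(3) .
  qed
  then have "(\<Sum>j=1..<m. 1 / cycle_rate m D j)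
      \<le> (\<Sum>j=1..<m. D * (real m)\<^sup>2 / 8 * (1 / (real j)\<^sup>2 + 1 / (real (m - j))\<^sup>2))"
    by (rule sum_mono)
  also have "\<dots> = D * (real m)\<^sup>2 / 8 * ((\<Sum>j=1..<m. 1 / (real j)\<^sup>2) + (\<Sum>j=1..<m. 1 / (real (m - j))\<^sup>2))"
    by (simp only: sum.distrib flip: sum_distrib_left)
  also have "(\<Sum>j=1..<m. 1 / (real (m - j))\<^sup>2) = (\<Sum>j=1..<m. 1 / (real j)\<^sup>2)"
    by (rule sum.reindex_bij_witness[of _ "\<lambda>j. m - j" "\<lambda>j. m - j"]) auto
  also have "D * (real m)\<^sup>2 / 8 * ((\<Sum>j=1..<m. 1 / (real j)\<^sup>2) + (\<Sum>j=1..<m. 1 / (real j)\<^sup>2)) \<le> D * (real m)\<^sup>2 / 8 * (2 + 2)"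
  proof -
    have "(\<Sum>j=1..<m. 1 / (real j)\<^sup>2) \<le> 2"
      using sum_inverse_squares_le[of "m - 1"] by (cases m) (auto simp: atLeastLessThanSuc_atLeastAtMost)
    then show ?thesis
      using assms by (intro mult_left_mono add_mono) auto
  qed
  finally show ?thesis
    by simp
qed

section \<open>Distance to equilibrium and local time\<close>

lemma ramanujan_regular_sym_graph:
  assumes "ramanujan k G" "0 < k"
  shows "regular_sym_graph G k"
proof -
  interpret pair_graph G
    using assms(1) by (simp add: ramanujan_def)
  show ?thesis
  proof
    show "finite (pverts G)" by (rule pair_finite_verts)
    show "pverts G \<noteq> {}"
      using assms(1) by (auto simp: ramanujan_def connected_conv)
    show "parcs G \<subseteq> pverts G \<times> pverts G"
      by (auto dest: in_arcsD1 in_arcsD2)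
    show "(x, y) \<in> parcs G \<Longrightarrow> (y, x) \<in> parcs G" for x y
      using pair_sym_arcs by (auto simp: symmetric_def sym_def)
    show "card (parcs G `` {x}) = k" if "x \<in> pverts G" for x
    proof -
      have "out_arcs (with_proj G) x = Pair x ` (parcs G `` {x})"
        by (auto simp: out_arcs_def)
      then have "out_degree (with_proj G) x = card (parcs G `` {x})"
        by (simp add: out_degree_def card_image inj_on_def)
      then show ?thesis
        using assms(1) that by (simp add: ramanujan_def regular_graph_def)
    qed
  qed (fact assms(2))
qed

context regular_sym_graph
begin

text \<open>By symmetry of the kernel, \<open>heat G t (indicator {x})\<close> doubles as the law at
  time \<open>t\<close> of the walk started from \<open>x\<close>.\<close>

lemma heat_expand:
  assumes "x \<in> pverts G"
  shows "heat G t f x = (\<Sum>p\<in>pverts G. f p * heat G t (indicator {x}) p)"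
proof -
  have "heat G t f x = heat G t (\<lambda>y. \<Sum>p\<in>pverts G. f p * indicator {p} y) x"
  proof (rule heat_cong[OF _ assms])
    fix y assume "y \<in> pverts G"
    then show "f y = (\<Sum>p\<in>pverts G. f p * indicator {p} y)"
      using finite_vertices by (simp add: indicator_def if_distrib[of "\<lambda>c. _ * c"] cong: if_cong)
  qed
  also have "\<dots> = (\<Sum>p\<in>pverts G. f p * heat G t (indicator {p}) x)"
    by (rule heat_sum[OF assms])
  also have "\<dots> = (\<Sum>p\<in>pverts G. f p * heat G t (indicator {x}) p)"
    using assms by (intro sum.cong refl) (simp add: heat_sym)
  finally show ?thesis .
qed

abbreviation "uniform_law \<equiv> measure_pmf (pmf_of_set (pverts G))"
text \<open>The \<open>L1\<close> distance, which replaces the supremum over events. Upper bounds on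
  \<open>tv_dist\<close> below simply use the full \<open>L1\<close> distance, while lower bounds
  use the sharp factor 2.\<close>

abbreviation "uniform_distance t x \<equiv> (\<Sum>p\<in>pverts G. \<bar>heat G t (indicator {x}) p - 1 / card (pverts G)\<bar>)"

lemma measure_diff_eq_sum:
  assumes "x \<in> pverts G" "0 \<le> t"
  shows "measure (walk_law G t x) A - measure uniform_law A
    = (\<Sum>p\<in>pverts G \<inter> A. heat G t (indicator {x}) p - 1 / card (pverts G))"
proof -
  have "measure (walk_law G t x) A = (\<Sum>p\<in>pverts G. indicator A p * heat G t (indicator {x}) p)"
    using assms by (simp only: measure_walk_law heat_expand)
  also have "\<dots> = (\<Sum>p\<in>pverts G \<inter> A. heat G t (indicator {x}) p)"
    using finite_vertices by (simp add: indicator_def sum.inter_restrict if_distrib[of "\<lambda>c. c * _"] cong: if_cong)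
  finally show ?thesis
    using finite_vertices vertices_nonempty by (simp add: measure_pmf_of_set sum_subtractf)
qed

lemma sum_heat_indicator:
  assumes "x \<in> pverts G"
  shows "(\<Sum>p\<in>pverts G. heat G t (indicator {x}) p) = 1"
  using heat_expand[OF assms, of t "\<lambda>_. 1"] heat_const[OF assms, of t 1] by simp

lemma abs_measure_diff_le:
  assumes "x \<in> pverts G" "0 \<le> t"
  shows "\<bar>measure (walk_law G t x) A - measure uniform_law A\<bar> \<le> uniform_distance t x"
  unfolding measure_diff_eq_sum[OF assms]
  by (rule order_trans[OF sum_abs]) (use finite_vertices in \<open>auto intro!: sum_mono2\<close>)

lemma tv_dist_le:
  assumes "x \<in> pverts G" "0 \<le> t"
  shows "tv_dist (walk_law G t x) uniform_law \<le> uniform_distance t x"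
  unfolding tv_dist_def by (intro cSUP_least abs_measure_diff_le assms) (auto simp: walk_law_def)

text \<open>The event where the law exceeds the uniform one is optimal: the deviations sum to zero,
  so their positive part carries half of the \<open>L1\<close> norm.\<close>

lemma uniform_distance_le:
  assumes "x \<in> pverts G" "0 \<le> t"
  shows "uniform_distance t x \<le> 2 * tv_dist (walk_law G t x) uniform_law"
proof -
  let ?u = "\<lambda>p. heat G t (indicator {x}) p - 1 / card (pverts G)"
  let ?A = "{p. 0 \<le> ?u p}"
  have "\<bar>measure (walk_law G t x) ?A - measure uniform_law ?A\<bar> \<le> tv_dist (walk_law G t x) uniform_law"
    unfolding tv_dist_def
    by (rule cSUP_upper) (auto simp: walk_law_def intro!: bdd_aboveI2 abs_measure_diff_le[OF assms, unfolded walk_law_def])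
  then have "(\<Sum>p\<in>pverts G \<inter> ?A. ?u p) \<le> tv_dist (walk_law G t x) uniform_law"
    unfolding measure_diff_eq_sum[OF assms] by simp
  moreover have "uniform_distance t x = 2 * (\<Sum>p\<in>pverts G \<inter> ?A. ?u p) - (\<Sum>p\<in>pverts G. ?u p)"
  proof -
    have "uniform_distance t x = (\<Sum>p\<in>pverts G. 2 * (if p \<in> ?A then ?u p else 0) - ?u p)"
      by (intro sum.cong) auto
    also have "\<dots> = 2 * (\<Sum>p\<in>pverts G. if p \<in> ?A then ?u p else 0) - (\<Sum>p\<in>pverts G. ?u p)"
      by (simp only: sum_subtractf sum_distrib_left)
    finally show ?thesis
      by (simp only: sum.inter_restrict[OF finite_vertices])
  qed
  moreover have "(\<Sum>p\<in>pverts G. ?u p) = 0"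
    using finite_vertices vertices_nonempty by (simp add: sum_subtractf sum_heat_indicator[OF assms(1)])
  ultimately show ?thesis
    by simp
qed

text \<open>\<open>mixing_time\<close> is an infimum of reals, so the lower bound also needs a
  nonempty set; the time \<open>T\<close> supplies a member. The threshold in \<open>ge\<close> is
  \<open>2 * \<epsilon>\<close> because the \<open>L1\<close> distance is at most twice the total
  variation.\<close>

lemma mixing_time_bounds:
  assumes le: "\<And>x. x \<in> pverts G \<Longrightarrow> uniform_distance T x \<le> \<epsilon>" and "0 \<le> T"
    and ge: "\<And>t. 0 \<le> t \<Longrightarrow> t < L \<Longrightarrow> \<exists>x\<in>pverts G. 2 * \<epsilon> < uniform_distance t x"
  shows "mixing_time G \<epsilon> \<le> T" "L \<le> mixing_time G \<epsilon>"
proof -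
  let ?S = "{t. 0 \<le> t \<and> (SUP x\<in>pverts G. tv_dist (walk_law G t x) uniform_law) \<le> \<epsilon>}"
  have "(SUP x\<in>pverts G. tv_dist (walk_law G T x) uniform_law) \<le> \<epsilon>"
    using vertices_nonempty assms by (intro cSUP_least) (auto intro: order_trans[OF tv_dist_le])
  then have T: "T \<in> ?S"
    using assms(2) by simp
  then show "mixing_time G \<epsilon> \<le> T"
    unfolding mixing_time_def by (intro cInf_lower) (auto intro!: bdd_belowI[of _ 0])
  show "L \<le> mixing_time G \<epsilon>"
    unfolding mixing_time_def
  proof (rule cInf_greatest)
    fix t assume t: "t \<in> ?S"
    show "L \<le> t"
    proof (rule ccontr)
      assume "\<not> L \<le> t"
      with t ge[of t] obtain x where x: "x \<in> pverts G" "2 * \<epsilon> < uniform_distance t x" by auto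
      have "tv_dist (walk_law G t x) uniform_law \<le> (SUP x\<in>pverts G. tv_dist (walk_law G t x) uniform_law)"
        using finite_vertices by (intro cSUP_upper x bdd_above_finite) simp
      with t x uniform_distance_le[OF x(1), of t] show False by simp
    qed
  qed (use T in blast)
qed

lemma heat_indicator_nonneg:
  assumes "x \<in> pverts G" "0 \<le> t"
  shows "0 \<le> heat G t (indicator A) x"
  unfolding prob_walk[OF assms, symmetric] by (rule measure_nonneg)

lemma continuous_on_heat: "x \<in> pverts G \<Longrightarrow> continuous_on A (\<lambda>u. heat G u f x)"
  using has_real_derivative_heat by (intro DERIV_continuous_on) (blast intro: has_field_derivative_at_within)

lemma expectation_local_time_diff:
  assumes "x \<in> pverts G" "0 \<le> s" "s \<le> T"
  shows "(LINT \<omega>|walk_space G. local_time x y T \<omega> - local_time x y s \<omega>) = integral {s..T} (\<lambda>u. heat G u (indicator {y}) x)"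
proof -
  let ?f = "\<lambda>u. heat G u (indicator {y}) x"
  have int: "?f integrable_on {a..b}" for a b
    by (intro integrable_continuous_real continuous_on_heat assms(1))
  have lint: "(LINT u:{0..b}|lborel. ?f u) = integral {0..b} ?f" for b
    by (intro set_borel_integral_eq_integral(2) borel_integrable_atLeastAtMost' continuous_on_heat assms(1))
  have "(LINT \<omega>|walk_space G. local_time x y T \<omega> - local_time x y s \<omega>) = integral {0..T} ?f - integral {0..s} ?f"
    using assms expectation_local_time[of x s y] expectation_local_time[of x T y]
    by (simp add: lint)
  also have "\<dots> = integral {s..T} ?f"
    using Henstock_Kurzweil_Integration.integral_combine[OF assms(2,3) int] by simp
  finally show ?thesis .
qed

end

lemma integral_exp_decay_le:
  fixes c :: real
  assumes "0 < c" "s \<le> T"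
  shows "(\<lambda>u. exp (- c * u)) integrable_on {s..T}" "integral {s..T} (\<lambda>u. exp (- c * u)) \<le> exp (- c * s) / c"
proof -
  have "((\<lambda>u. exp (- c * u)) has_integral (- exp (- c * T) / c - (- exp (- c * s) / c))) {s..T}"
  proof (rule fundamental_theorem_of_calculus[OF assms(2)])
    fix u
    show "((\<lambda>u. - exp (- c * u) / c) has_vector_derivative exp (- c * u)) (at u within {s..T})"
      using assms(1) unfolding has_real_derivative_iff_has_vector_derivative[symmetric]
      by (auto intro!: derivative_eq_intros)
  qed
  then show "(\<lambda>u. exp (- c * u)) integrable_on {s..T}" "integral {s..T} (\<lambda>u. exp (- c * u)) \<le> exp (- c * s) / c"
    using assms(1) by (auto simp: integral_unique has_integral_integrable)
qed

section \<open>The product of a cycle and a Ramanujan graph\<close>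

text \<open>From \<open>m = 3\<close> on the cycle is 2-regular; the limit only concerns large
  \<open>m\<close>.\<close>

locale cycle_times_ramanujan =
  fixes m k :: nat and H :: "'a pair_pre_digraph"
  assumes m_ge_3: "3 \<le> m" and k_gt_3: "3 < k" and ramanujan: "ramanujan k H"

sublocale cycle_times_ramanujan \<subseteq> cartesian_product_graph "cycle_graph m" 2 H k
proof -
  interpret G: regular_sym_graph "cycle_graph m" 2
    using m_ge_3 by (rule regular_sym_graph_cycle)
  interpret H: regular_sym_graph H k
    using ramanujan k_gt_3 by (intro ramanujan_regular_sym_graph) simp_all
  show "cartesian_product_graph (cycle_graph m) 2 H k"
    using m_ge_3 by unfold_locales (rule cycle_graph_irrefl, simp)
qed

context cycle_times_ramanujan
begin

abbreviation "deg \<equiv> real k + 2"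
abbreviation "rate \<equiv> cycle_rate m deg"
abbreviation "vol \<equiv> real (card (pverts \<Gamma>))"

definition gap :: real where
  "gap = (real k - 2 * sqrt (real k - 1)) / deg"

lemma gap_pos: "0 < gap"
proof -
  have "sqrt (real k - 1) < real k / 2"
  proof (rule real_less_lsqrt)
    \<comment> \<open>Expanded, this is exactly \<open>4 (k - 1) < k^2\<close>.\<close>
    have "0 < (real k - 2)\<^sup>2"
      using k_gt_3 by simp
    then show "real k - 1 < (real k / 2)\<^sup>2"
      by (simp add: power2_diff power_divide)
  qed simp
  then show ?thesis
    unfolding gap_def using k_gt_3 by (intro divide_pos_pos) auto
qed

lemma verts_cycle: "pverts (cycle_graph m) = {..<m}"
  by (simp add: cycle_graph_def)

lemma vertex_iff: "(i, x) \<in> pverts \<Gamma> \<longleftrightarrow> i < m \<and> x \<in> pverts H"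
  by (simp add: pverts_cartesian_product verts_cycle)

lemma vol_eq: "vol = real m * real (card (pverts H))"
  by (simp add: pverts_cartesian_product verts_cycle card_cartesian_product)

lemma vol_pos: "0 < vol"
  using finite_vertices vertices_nonempty by (simp add: card_gt_0_iff)

lemma card_H_pos: "0 < real (card (pverts H))"
  using H.finite_vertices H.vertices_nonempty by (simp add: card_gt_0_iff)

text \<open>Centring the cosines at \<open>a\<close> lets real waves alone expand a point mass at
  \<open>a\<close>: summed over \<open>j\<close> they give \<open>m\<close> at \<open>a\<close> and
  0 elsewhere on the cycle.\<close>

definition wave :: "nat \<Rightarrow> nat \<Rightarrow> nat \<times> 'a \<Rightarrow> real" where
  "wave j a = (\<lambda>p. cos (2 * pi * real j * (real (fst p) - real a) / m))"

lemma rate_eq: "rate j = 2 * (1 - cos (2 * pi * j / m)) / deg"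
proof -
  have "cos (2 * (pi * j / m)) = 1 - 2 * (sin (pi * j / m))\<^sup>2"
    by (rule cos_double_sin)
  then have "cos (2 * pi * j / m) = 1 - 2 * (sin (pi * j / m))\<^sup>2"
    by (simp only: times_divide_eq_right mult.assoc)
  then show ?thesis
    by (simp add: cycle_rate_def)
qed

lemma neighbour_average_wave:
  assumes "p \<in> pverts \<Gamma>"
  shows "neighbour_average \<Gamma> (wave j a) p = (1 - rate j) * wave j a p"
proof -
  obtain i x where [simp]: "p = (i, x)" and ix: "i < m" "x \<in> pverts H"
    using assms by (cases p) (auto simp: vertex_iff)
  have "neighbour_average H (\<lambda>y. wave j a (i, y)) x = wave j a (i, x)"
    using ix(2) H.has_neighbour[OF ix(2)] H.finite_neighbours[of x]
    by (simp add: wave_def neighbour_average_def)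
  moreover have "neighbour_average (cycle_graph m) (\<lambda>b. wave j a (b, x)) i = cos (2 * pi * j / m) * wave j a (i, x)"
    using neighbour_average_cycle[OF m_ge_3 ix(1)] by (simp add: wave_def)
  ultimately have "neighbour_average \<Gamma> (wave j a) p = (2 * cos (2 * pi * j / m) + k) / deg * wave j a p"
    using ix by (simp add: neighbour_average_product verts_cycle algebra_simps add_divide_distrib)
  moreover have "(2 * cos (2 * pi * j / m) + k) / deg = 1 - rate j"
    unfolding rate_eq using k_gt_3 by (simp add: field_simps)
  ultimately show ?thesis by simp
qed

lemma heat_wave: "p \<in> pverts \<Gamma> \<Longrightarrow> heat \<Gamma> t (wave j a) p = exp (- rate j * t) * wave j a p"
  using heat_eigenfunction[OF neighbour_average_wave] by simp

definition remainder :: "nat \<times> 'a \<Rightarrow> nat \<times> 'a \<Rightarrow> real" where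
  "remainder v p = (if fst p = fst v then indicator {snd v} (snd p) - 1 / card (pverts H) else 0)"

text \<open>The waves together form the uniform distribution on the fibre through \<open>v\<close>;
  \<open>remainder\<close> is the deviation of the point mass from it inside that fibre.\<close>

lemma indicator_eq:
  assumes "v \<in> pverts \<Gamma>" "p \<in> pverts \<Gamma>"
  shows "indicator {v} p = (\<Sum>j<m. 1 / vol * wave j (fst v) p) + remainder v p"
proof -
  have "(\<Sum>j<m. wave j (fst v) p) = (if fst p = fst v then real m else 0)"
    using sum_cos_multiples[of "fst p" m "fst v"] assms
    by (cases p; cases v) (simp add: wave_def vertex_iff)
  then have "(\<Sum>j<m. 1 / vol * wave j (fst v) p) = (if fst p = fst v then 1 / card (pverts H) else 0)"
    unfolding sum_distrib_left[symmetric] using m_ge_3 by (simp add: vol_eq)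
  then show ?thesis
    by (cases p; cases v) (simp add: remainder_def indicator_def)
qed

lemma sum_remainder:
  assumes "v \<in> pverts \<Gamma>"
  shows "(\<Sum>x\<in>pverts H. remainder v (i, x)) = 0"
proof (cases "i = fst v")
  case True
  have "(\<Sum>x\<in>pverts H. indicator {snd v} x) = (1 :: real)"
    using assms H.finite_vertices by (cases v) (simp add: vertex_iff indicator_def)
  then show ?thesis
    using True card_H_pos by (simp add: remainder_def sum_subtractf)
qed (simp add: remainder_def)

text \<open>Subtracting the fibre mean is an orthogonal projection applied to a unit vector; the
  exact value is 1 minus the inverse fibre size.\<close>

lemma sum_remainder_squared_le:
  assumes "v \<in> pverts \<Gamma>"
  shows "(\<Sum>p\<in>pverts \<Gamma>. (remainder v p)\<^sup>2) \<le> 1"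
proof -
  obtain a y where [simp]: "v = (a, y)" and ay: "a < m" "y \<in> pverts H"
    using assms by (cases v) (auto simp: vertex_iff)
  let ?N = "real (card (pverts H))"
  have "(\<Sum>p\<in>pverts \<Gamma>. (remainder v p)\<^sup>2) = (\<Sum>i<m. if i = a then \<Sum>x\<in>pverts H. (indicator {y} x - 1 / ?N)\<^sup>2 else 0)"
    unfolding pverts_cartesian_product verts_cycle sum.cartesian_product'
    by (intro sum.cong refl) (simp add: remainder_def)
  also have "\<dots> = (\<Sum>x\<in>pverts H. (indicator {y} x - 1 / ?N)\<^sup>2)"
    using ay by simp
  also have "\<dots> = (\<Sum>x\<in>pverts H. (1 - 2 / ?N) * indicator {y} x + 1 / ?N\<^sup>2)"
    by (intro sum.cong refl) (simp add: indicator_def power2_diff power_divide)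
  also have "\<dots> = (1 - 2 / ?N) + 1 / ?N"
    using ay H.finite_vertices H.vertices_nonempty
    by (simp add: sum.distrib power2_eq_square flip: sum_distrib_left) (simp add: indicator_def)
  also have "\<dots> \<le> 1"
    using card_H_pos by simp
  finally show ?thesis .
qed

lemma heat_remainder_squared_le:
  assumes "v \<in> pverts \<Gamma>" "0 \<le> t"
  shows "(\<Sum>p\<in>pverts \<Gamma>. (heat \<Gamma> t (remainder v) p)\<^sup>2) \<le> (exp (- gap * t))\<^sup>2"
proof -
  have "(\<Sum>p\<in>pverts \<Gamma>. (heat \<Gamma> t (remainder v) p)\<^sup>2)
      \<le> exp (- 2 * ((real k - 2 * sqrt (real k - 1)) / (real 2 + real k)) * t) * (\<Sum>p\<in>pverts \<Gamma>. (remainder v p)\<^sup>2)"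
    using fibre_heat_contraction[OF H.ramanujan_gap[OF ramanujan] sum_remainder[OF assms(1)] assms(2)] by simp
  also have "\<dots> \<le> exp (- 2 * ((real k - 2 * sqrt (real k - 1)) / (real 2 + real k)) * t) * 1"
    by (intro mult_left_mono sum_remainder_squared_le assms(1)) simp
  also have "\<dots> = (exp (- gap * t))\<^sup>2"
  proof -
    have "(real k - 2 * sqrt (real k - 1)) / (real 2 + real k) = gap"
      by (simp add: gap_def add.commute)
    then show ?thesis
      by (simp add: mult.assoc flip: exp_double)
  qed
  finally show ?thesis .
qed

lemma abs_heat_remainder_le:
  assumes "v \<in> pverts \<Gamma>" "0 \<le> t" "p \<in> pverts \<Gamma>"
  shows "\<bar>heat \<Gamma> t (remainder v) p\<bar> \<le> exp (- gap * t)"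
proof -
  have "(heat \<Gamma> t (remainder v) p)\<^sup>2 \<le> (\<Sum>p\<in>pverts \<Gamma>. (heat \<Gamma> t (remainder v) p)\<^sup>2)"
    using assms finite_vertices by (intro member_le_sum) auto
  also note heat_remainder_squared_le[OF assms(1,2)]
  finally show ?thesis
    using abs_le_square_iff[of "heat \<Gamma> t (remainder v) p" "exp (- gap * t)"] by simp
qed

text \<open>Cauchy-Schwarz against the constant 1, the source of the factor
  \<open>sqrt vol\<close>.\<close>

lemma sum_abs_heat_remainder_le:
  assumes "v \<in> pverts \<Gamma>" "0 \<le> t"
  shows "(\<Sum>p\<in>pverts \<Gamma>. \<bar>heat \<Gamma> t (remainder v) p\<bar>) \<le> sqrt vol * exp (- gap * t)"
proof -
  have "(\<Sum>p\<in>pverts \<Gamma>. \<bar>1\<bar> * \<bar>heat \<Gamma> t (remainder v) p\<bar>)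
      \<le> L2_set (\<lambda>_. 1) (pverts \<Gamma>) * L2_set (heat \<Gamma> t (remainder v)) (pverts \<Gamma>)"
    by (rule L2_set_mult_ineq)
  also have "L2_set (heat \<Gamma> t (remainder v)) (pverts \<Gamma>) \<le> sqrt ((exp (- gap * t))\<^sup>2)"
    unfolding L2_set_def by (intro real_sqrt_le_mono heat_remainder_squared_le assms)
  finally show ?thesis
    by (simp add: L2_set_def mult_left_mono)
qed

lemma heat_indicator_eq:
  assumes "v \<in> pverts \<Gamma>" "p \<in> pverts \<Gamma>"
  shows "heat \<Gamma> t (indicator {v}) p
    = (\<Sum>j<m. exp (- rate j * t) * wave j (fst v) p) / vol + heat \<Gamma> t (remainder v) p"
proof -
  have "heat \<Gamma> t (indicator {v}) p = heat \<Gamma> t (\<lambda>p. (\<Sum>j<m. 1 / vol * wave j (fst v) p) + remainder v p) p"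
    by (rule heat_cong[OF indicator_eq[OF assms(1)] assms(2)])
  also have "\<dots> = (\<Sum>j<m. 1 / vol * (exp (- rate j * t) * wave j (fst v) p)) + heat \<Gamma> t (remainder v) p"
    by (simp only: heat_add[OF assms(2)] heat_sum[OF assms(2)] heat_wave[OF assms(2)])
  finally show ?thesis
    by (simp add: sum_divide_distrib)
qed

lemma sum_lessThan_split: "(\<Sum>j<m. f j) = f 0 + (\<Sum>j=1..<m. f j :: real)"
  using m_ge_3 by (simp add: lessThan_atLeast0 sum.atLeast_Suc_lessThan)

lemma rate_0: "rate 0 = 0"
  by (simp add: cycle_rate_def)

lemma rate_pos: "j \<in> {1..<m} \<Longrightarrow> 0 < rate j"
  by (rule cycle_rate_pos) auto

text \<open>At the starting point all waves equal 1, and the wave \<open>j = 0\<close> has rate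
  0.\<close>

lemma return_probability_le:
  assumes "v \<in> pverts \<Gamma>" "0 \<le> t"
  shows "heat \<Gamma> t (indicator {v}) v \<le> (1 + (\<Sum>j=1..<m. exp (- rate j * t))) / vol + exp (- gap * t)"
  using heat_indicator_eq[OF assms(1,1), of t] abs_heat_remainder_le[OF assms assms(1)]
  by (simp add: wave_def sum_lessThan_split rate_0)

text \<open>The wave \<open>j = 0\<close> is the uniform density and cancels; the other waves are
  bounded by 1, so summing over all vertices removes the factor \<open>1 / vol\<close>.\<close>

lemma uniform_distance_upper:
  assumes "v \<in> pverts \<Gamma>" "0 \<le> t"
  shows "uniform_distance t v \<le> (\<Sum>j=1..<m. exp (- rate j * t)) + sqrt vol * exp (- gap * t)"
proof -
  have "\<bar>heat \<Gamma> t (indicator {v}) p - 1 / vol\<bar>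
      \<le> (\<Sum>j=1..<m. exp (- rate j * t)) / vol + \<bar>heat \<Gamma> t (remainder v) p\<bar>" if "p \<in> pverts \<Gamma>" for p
  proof -
    have "heat \<Gamma> t (indicator {v}) p - 1 / vol
        = (\<Sum>j=1..<m. exp (- rate j * t) * wave j (fst v) p) / vol + heat \<Gamma> t (remainder v) p"
      unfolding heat_indicator_eq[OF assms(1) that] sum_lessThan_split
      by (simp add: rate_0 wave_def add_divide_distrib)
    moreover have "\<bar>\<Sum>j=1..<m. exp (- rate j * t) * wave j (fst v) p\<bar> \<le> (\<Sum>j=1..<m. exp (- rate j * t))"
      by (rule order_trans[OF sum_abs]) (auto intro!: sum_mono simp: abs_mult wave_def)
    then have "\<bar>(\<Sum>j=1..<m. exp (- rate j * t) * wave j (fst v) p) / vol\<bar> \<le> (\<Sum>j=1..<m. exp (- rate j * t)) / vol"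
      using vol_pos by (simp add: divide_right_mono)
    ultimately show ?thesis by linarith
  qed
  then have "uniform_distance t v \<le> (\<Sum>p\<in>pverts \<Gamma>. (\<Sum>j=1..<m. exp (- rate j * t)) / vol + \<bar>heat \<Gamma> t (remainder v) p\<bar>)"
    by (rule sum_mono)
  also have "\<dots> = (\<Sum>j=1..<m. exp (- rate j * t)) + (\<Sum>p\<in>pverts \<Gamma>. \<bar>heat \<Gamma> t (remainder v) p\<bar>)"
    using vol_pos by (simp add: sum.distrib)
  finally show ?thesis
    using sum_abs_heat_remainder_le[OF assms] by linarith
qed

text \<open>Tests the deviation from uniformity against \<open>wave 1\<close>, which has mean zero,
  absolute value at most 1, the value 1 at \<open>v\<close>, and decays at the rate
  \<open>rate 1\<close>.\<close>

lemma uniform_distance_lower: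
  assumes "v \<in> pverts \<Gamma>"
  shows "exp (- rate 1 * t) \<le> uniform_distance t v"
proof -
  let ?w = "wave 1 (fst v)"
  \<comment> \<open>Averaging preserves the total sum but multiplies the wave by
    \<open>1 - rate 1\<close>, which is not 1; hence the sum is zero.\<close>
  have "(\<Sum>p\<in>pverts \<Gamma>. ?w p) = (\<Sum>p\<in>pverts \<Gamma>. (1 - rate 1) * ?w p)"
    by (subst sum_neighbour_average[symmetric]) (intro sum.cong refl neighbour_average_wave)
  then have "rate 1 * (\<Sum>p\<in>pverts \<Gamma>. ?w p) = 0"
    unfolding sum_distrib_left[symmetric] by (simp add: left_diff_distrib)
  then have "(\<Sum>p\<in>pverts \<Gamma>. ?w p) = 0"
    using rate_pos[of 1] m_ge_3 by simp
  have "exp (- rate 1 * t) = heat \<Gamma> t ?w v"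
    using assms by (simp add: heat_wave) (simp add: wave_def)
  also have "\<dots> = (\<Sum>p\<in>pverts \<Gamma>. ?w p * heat \<Gamma> t (indicator {v}) p)"
    by (rule heat_expand[OF assms])
  also have "\<dots> = (\<Sum>p\<in>pverts \<Gamma>. ?w p * (heat \<Gamma> t (indicator {v}) p - 1 / vol))"
    using \<open>(\<Sum>p\<in>pverts \<Gamma>. ?w p) = 0\<close> by (simp add: right_diff_distrib sum_subtractf flip: sum_divide_distrib)
  also have "\<dots> \<le> (\<Sum>p\<in>pverts \<Gamma>. \<bar>heat \<Gamma> t (indicator {v}) p - 1 / vol\<bar>)"
  proof (rule sum_mono)
    fix p
    have "?w p * (heat \<Gamma> t (indicator {v}) p - 1 / vol) \<le> \<bar>?w p\<bar> * \<bar>heat \<Gamma> t (indicator {v}) p - 1 / vol\<bar>"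
      by (metis abs_ge_self abs_mult)
    also have "\<dots> \<le> 1 * \<bar>heat \<Gamma> t (indicator {v}) p - 1 / vol\<bar>"
      by (intro mult_right_mono) (simp_all add: wave_def)
    finally show "?w p * (heat \<Gamma> t (indicator {v}) p - 1 / vol) \<le> \<bar>heat \<Gamma> t (indicator {v}) p - 1 / vol\<bar>"
      by simp
  qed
  finally show ?thesis .
qed

text \<open>The budget 1/4 is split in two. With \<open>exp(-x) \<le> 1/x\<close> and the inverse
  rates summing to at most \<open>deg m^2 / 2\<close>, the time \<open>4 deg m^2\<close> leaves 1/8
  for the waves; the assumption gives 1/8 for the remainder. The lower time is where
  \<open>exp(-4 \<pi>^2 t / (deg m^2))\<close> falls to 1/2, twice the mixing threshold.\<close>

lemma mixing_time_upper_lower: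
  assumes "sqrt vol * exp (- gap * (4 * deg * (real m)\<^sup>2)) \<le> 1 / 8"
  shows "mixing_time \<Gamma> (1/4) \<le> 4 * deg * (real m)\<^sup>2" "(real m)\<^sup>2 * ln 2 * deg / (4 * pi\<^sup>2) \<le> mixing_time \<Gamma> (1/4)"
proof -
  let ?T = "4 * deg * (real m)\<^sup>2" and ?L = "(real m)\<^sup>2 * ln 2 * deg / (4 * pi\<^sup>2)"
  have m: "0 < real m" and T: "0 < ?T" using m_ge_3 by simp_all
  have upper: "uniform_distance ?T v \<le> 1/4" if "v \<in> pverts \<Gamma>" for v
  proof -
    have "(\<Sum>j=1..<m. exp (- rate j * ?T)) \<le> (\<Sum>j=1..<m. 1 / rate j) / ?T"
      unfolding sum_divide_distrib
    proof (rule sum_mono)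
      fix j assume "j \<in> {1..<m}"
      then have pos: "0 < rate j * ?T"
        using T by (intro mult_pos_pos[OF rate_pos])
      have "rate j * ?T \<le> exp (rate j * ?T)"
        using exp_ge_add_one_self[of "rate j * ?T"] by linarith
      then have "1 / exp (rate j * ?T) \<le> 1 / (rate j * ?T)"
        using pos by (intro frac_le) auto
      then show "exp (- rate j * ?T) \<le> 1 / rate j / ?T"
        by (simp add: exp_minus inverse_eq_divide)
    qed
    also have "\<dots> \<le> (deg * (real m)\<^sup>2 / 2) / ?T"
      using T by (intro divide_right_mono sum_inverse_cycle_rate_le) auto
    also have "\<dots> = 1 / 8"
      using m by (simp add: divide_simps)
    finally show ?thesis
      using uniform_distance_upper[OF that, of ?T] assms T by simp
  qed
  have lower: "\<exists>v\<in>pverts \<Gamma>. 2 * (1/4) < uniform_distance t v" if t: "0 \<le> t" "t < ?L" for t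
  proof -
    obtain v where v: "v \<in> pverts \<Gamma>" using vertices_nonempty by blast
    have "sin (pi / m) \<le> pi / m" "0 \<le> sin (pi / m)"
      using m_ge_3 by (auto intro!: sin_x_le_x sin_ge_zero simp: divide_le_eq)
    then have "rate 1 \<le> 4 * (pi / m)\<^sup>2 / deg"
      unfolding cycle_rate_def by (intro divide_right_mono mult_left_mono power_mono) auto
    then have "rate 1 * t \<le> 4 * (pi / m)\<^sup>2 / deg * t"
      using t by (intro mult_right_mono)
    also have "\<dots> < 4 * (pi / m)\<^sup>2 / deg * ?L"
      using t m by (intro mult_strict_left_mono) auto
    also have "\<dots> = ln 2"
    proof -
      have "4 * (pi / M)\<^sup>2 / D * (M\<^sup>2 * ln 2 * D / (4 * pi\<^sup>2)) = ln 2" if "0 < M" "0 < D" for M D :: real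
        using that by (simp add: power_divide)
      from this[OF m, of deg] show ?thesis by simp
    qed
    finally have "exp (- ln 2) < exp (- rate 1 * t)"
      by simp
    also have "\<dots> \<le> uniform_distance t v"
      by (rule uniform_distance_lower[OF v])
    finally show ?thesis
      using v by (intro bexI[of _ v]) (simp_all add: exp_minus)
  qed
  show "mixing_time \<Gamma> (1/4) \<le> ?T" "?L \<le> mixing_time \<Gamma> (1/4)"
    using mixing_time_bounds[OF upper less_imp_le[OF T] lower] by blast+
qed

text \<open>Each decaying wave integrates to at most its inverse rate, whatever the length of the
  interval; only the constant wave contributes in proportion to \<open>T\<close>.\<close>

lemma integral_return_probability:
  assumes "v \<in> pverts \<Gamma>" "0 \<le> s" "s \<le> T"
  shows "0 \<le> integral {s..T} (\<lambda>u. heat \<Gamma> u (indicator {v}) v)"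
    and "integral {s..T} (\<lambda>u. heat \<Gamma> u (indicator {v}) v) \<le> (T + deg * (real m)\<^sup>2 / 2) / vol + exp (- gap * s) / gap"
proof -
  have int: "(\<lambda>u. heat \<Gamma> u (indicator {v}) v) integrable_on {s..T}"
    by (intro integrable_continuous_real continuous_on_heat assms(1))
  show "0 \<le> integral {s..T} (\<lambda>u. heat \<Gamma> u (indicator {v}) v)"
    using assms by (intro integral_nonneg int heat_indicator_nonneg) auto
  have rate_int: "(\<lambda>u. exp (- rate j * u)) integrable_on {s..T}" if "j \<in> {1..<m}" for j
    by (rule integral_exp_decay_le(1)[OF rate_pos[OF that] assms(3)])
  have gap_int: "(\<lambda>u. exp (- gap * u)) integrable_on {s..T}"
    by (rule integral_exp_decay_le(1)[OF gap_pos assms(3)])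
  have sum_int: "(\<lambda>u. \<Sum>j=1..<m. exp (- rate j * u)) integrable_on {s..T}"
    by (intro integrable_sum rate_int) simp_all
  have "integral {s..T} (\<lambda>u. heat \<Gamma> u (indicator {v}) v)
      \<le> integral {s..T} (\<lambda>u. (1 + (\<Sum>j=1..<m. exp (- rate j * u))) / vol + exp (- gap * u))"
    using assms by (intro integral_le int integrable_add integrable_on_divide integrable_const_ivl sum_int gap_int
        return_probability_le) auto
  also have "\<dots> = ((T - s) + (\<Sum>j=1..<m. integral {s..T} (\<lambda>u. exp (- rate j * u)))) / vol
      + integral {s..T} (\<lambda>u. exp (- gap * u))"
  proof -
    have "integral {s..T} (\<lambda>u. \<Sum>j=1..<m. exp (- rate j * u)) = (\<Sum>j=1..<m. integral {s..T} (\<lambda>u. exp (- rate j * u)))"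
      by (intro integral_sum rate_int) simp_all
    then show ?thesis
      using assms(3) gap_int sum_int
      by (simp add: integral_add integrable_add integrable_on_divide integrable_const_ivl)
  qed
  also have "\<dots> \<le> (T + deg * (real m)\<^sup>2 / 2) / vol + exp (- gap * s) / gap"
  proof (intro add_mono divide_right_mono)
    have "(\<Sum>j=1..<m. integral {s..T} (\<lambda>u. exp (- rate j * u))) \<le> (\<Sum>j=1..<m. 1 / rate j)"
    proof (rule sum_mono)
      fix j assume j: "j \<in> {1..<m}"
      have "integral {s..T} (\<lambda>u. exp (- rate j * u)) \<le> exp (- rate j * s) / rate j"
        by (rule integral_exp_decay_le(2)[OF rate_pos[OF j] assms(3)])
      also have "\<dots> \<le> 1 / rate j"
        using rate_pos[OF j] assms(2) by (intro divide_right_mono) auto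
      finally show "integral {s..T} (\<lambda>u. exp (- rate j * u)) \<le> 1 / rate j" .
    qed
    also have "\<dots> \<le> deg * (real m)\<^sup>2 / 2"
      by (rule sum_inverse_cycle_rate_le) simp
    finally show "(\<Sum>j=1..<m. integral {s..T} (\<lambda>u. exp (- rate j * u))) \<le> deg * (real m)\<^sup>2 / 2" .
    show "integral {s..T} (\<lambda>u. exp (- gap * u)) \<le> exp (- gap * s) / gap"
      by (rule integral_exp_decay_le(2)[OF gap_pos assms(3)])
  qed (use assms in auto)
  finally show "integral {s..T} (\<lambda>u. heat \<Gamma> u (indicator {v}) v) \<le> (T + deg * (real m)\<^sup>2 / 2) / vol + exp (- gap * s) / gap" .
qed

end

section \<open>Connectedness and diameter of the product\<close>

lemma (in regular_sym_graph) wf_digraph_with_proj: "wf_digraph (with_proj G)"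
  using arcs_in_vertices by unfold_locales auto

text \<open>A function that grows by at most 1 per arc bounds every path length from below.
  Connectedness matters because \<open>real_of_ereal\<close> sends an infinite supremum to 0, so
  finiteness has to be shown first.\<close>

lemma (in regular_sym_graph) diam_ge:
  fixes \<delta> :: "'v \<Rightarrow> real"
  assumes conn: "\<And>u v. u \<in> pverts G \<Longrightarrow> v \<in> pverts G \<Longrightarrow> u \<rightarrow>\<^sup>*\<^bsub>with_proj G\<^esub> v"
    and lip: "\<And>u v. (u, v) \<in> parcs G \<Longrightarrow> \<delta> v \<le> \<delta> u + 1"
    and "x \<in> pverts G" "y \<in> pverts G"
  shows "\<delta> y - \<delta> x \<le> diam G"
proof -
  interpret wf_digraph "with_proj G" by (rule wf_digraph_with_proj)
  have walk: "\<delta> v - \<delta> u \<le> awalk_cost (\<lambda>_. 1) p" if "awalk u p v" for u p v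
    using that
  proof (induction p arbitrary: u)
    case (Cons e p)
    then have "e \<in> parcs G" "u = fst e" "awalk (snd e) p v"
      by (simp_all add: awalk_Cons_iff)
    with Cons.IH[of "snd e"] lip[of "fst e" "snd e"] show ?case by simp
  qed (simp add: awalk_Nil_iff)
  let ?D = "SUP x\<in>pverts G. SUP y\<in>pverts G. graph_distance G x y"
  have finite_dist: "graph_distance G u v < \<infinity>" if uv: "u \<in> pverts G" "v \<in> pverts G" for u v
  proof -
    obtain p where "awalk u p v"
      using conn[OF uv] by (auto simp: reachable_awalk)
    then have "graph_distance G u v \<le> ereal (awalk_cost (\<lambda>_. 1) p)"
      unfolding graph_distance_def by (rule min_cost_le_walk_cost)
    also have "\<dots> < \<infinity>" by simp
    finally show ?thesis .
  qed
  have finite_SUP: "(SUP v\<in>pverts G. f v) < \<infinity>" if "\<And>v. v \<in> pverts G \<Longrightarrow> f v < \<infinity>" for f :: "'v \<Rightarrow> ereal"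
    using that finite_imp_Sup_less[OF finite_imageI[OF finite_vertices] imageI[OF assms(3)], of f \<infinity>] by blast
  have "?D < \<infinity>"
    by (intro finite_SUP finite_dist)
  have "ereal (\<delta> y - \<delta> x) \<le> graph_distance G x y"
    unfolding graph_distance_def \<mu>_def using walk by (auto intro!: INF_greatest)
  also have "\<dots> \<le> ?D"
    using assms(3,4) by (intro SUP_upper2[of x] SUP_upper) auto
  finally have "ereal (\<delta> y - \<delta> x) \<le> ?D" .
  with \<open>?D < \<infinity>\<close> show ?thesis
    unfolding diam_def by (cases ?D) auto
qed

context cycle_times_ramanujan
begin

lemma product_arcs:
  "x \<in> pverts H \<Longrightarrow> Suc i < m \<Longrightarrow> ((i, x), (Suc i, x)) \<in> parcs \<Gamma>"
  "x \<in> pverts H \<Longrightarrow> Suc i < m \<Longrightarrow> ((Suc i, x), (i, x)) \<in> parcs \<Gamma>"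
  "(x, y) \<in> parcs H \<Longrightarrow> i < m \<Longrightarrow> ((i, x), (i, y)) \<in> parcs \<Gamma>"
  by (auto simp: cartesian_product_def cycle_graph_def)

text \<open>Walk down to layer 0 without wrapping around, cross inside the copy of \<open>H\<close>
  there, and climb to the target layer.\<close>

lemma product_connected:
  assumes "u \<in> pverts \<Gamma>" "v \<in> pverts \<Gamma>"
  shows "u \<rightarrow>\<^sup>*\<^bsub>with_proj \<Gamma>\<^esub> v"
proof -
  interpret W: wf_digraph "with_proj \<Gamma>" by (rule wf_digraph_with_proj)
  interpret P: pair_graph H using ramanujan by (simp add: ramanujan_def)
  obtain i x j y where uv: "u = (i, x)" "v = (j, y)" and ij: "i < m" "j < m" and xy: "x \<in> pverts H" "y \<in> pverts H"
    using assms by (cases u; cases v) (auto simp: vertex_iff)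
  have up: "(0, z) \<rightarrow>\<^sup>*\<^bsub>with_proj \<Gamma>\<^esub> (l, z)" if "l < m" "z \<in> pverts H" for l z
    using that
  proof (induction l)
    case 0
    then show ?case by (simp add: vertex_iff)
  next
    case (Suc l)
    then have "(0, z) \<rightarrow>\<^sup>*\<^bsub>with_proj \<Gamma>\<^esub> (l, z)" by simp
    also have "(l, z) \<rightarrow>\<^bsub>with_proj \<Gamma>\<^esub> (Suc l, z)"
      using product_arcs(1)[of z l] Suc.prems by simp
    finally show ?case .
  qed
  have down: "(l, z) \<rightarrow>\<^sup>*\<^bsub>with_proj \<Gamma>\<^esub> (0, z)" if "l < m" "z \<in> pverts H" for l z
    using that
  proof (induction l)
    case 0
    then show ?case by (simp add: vertex_iff)
  next
    case (Suc l)
    have "(Suc l, z) \<rightarrow>\<^bsub>with_proj \<Gamma>\<^esub> (l, z)"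
      using product_arcs(2)[of z l] Suc.prems by simp
    also have "(l, z) \<rightarrow>\<^sup>*\<^bsub>with_proj \<Gamma>\<^esub> (0, z)"
      using Suc by simp
    finally show ?case .
  qed
  have "strongly_connected (with_proj H)"
    using ramanujan P.pair_sym_arcs P.symmetric_connected_imp_strongly_connected by (simp add: ramanujan_def)
  then have "x \<rightarrow>\<^sup>*\<^bsub>with_proj H\<^esub> y"
    using xy by (auto simp: strongly_connected_def)
  then have "(x, y) \<in> rtrancl_on (pverts H) (parcs H)"
    by (simp add: reachable_def)
  then have "(0, x) \<rightarrow>\<^sup>*\<^bsub>with_proj \<Gamma>\<^esub> (0, y)"
  proof (induction rule: rtrancl_on_induct)
    case base
    then show ?case using m_ge_3 by (simp add: vertex_iff)
  next
    case (step y z)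
    note step.IH
    also have "(0, y) \<rightarrow>\<^bsub>with_proj \<Gamma>\<^esub> (0, z)"
      using product_arcs(3)[OF step.hyps(2), of 0] m_ge_3 by simp
    finally show ?case .
  qed
  then show ?thesis
    unfolding uv using W.reachable_trans[OF W.reachable_trans[OF down[OF ij(1) xy(1)]] up[OF ij(2) xy(2)]] by blast
qed

text \<open>The test function is the cycle distance to 0. Moves in \<open>H\<close> do not change
  it, and for even \<open>m\<close> it reaches \<open>m / 2\<close> at the antipode.\<close>

lemma diam_product_ge:
  assumes "even m"
  shows "real m / 2 \<le> diam \<Gamma>"
proof -
  let ?\<delta> = "\<lambda>p :: nat \<times> 'a. real (min (fst p) (m - fst p))"
  obtain x where x: "x \<in> pverts H" using H.vertices_nonempty by blast
  have "min j (m - j) \<le> min i (m - i) + 1" if "(i, j) \<in> parcs (cycle_graph m)" for i j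
    using that by (auto simp: cycle_graph_def mod_if split: if_splits)
  then have "?\<delta> v \<le> ?\<delta> u + 1" if "(u, v) \<in> parcs \<Gamma>" for u v
    using that by (fastforce simp: cartesian_product_def)
  then have "?\<delta> (m div 2, x) - ?\<delta> (0, x) \<le> diam \<Gamma>"
    using x m_ge_3 by (intro diam_ge product_connected) (auto simp: vertex_iff)
  moreover have "min (m div 2) (m - m div 2) = m div 2" "real (m div 2) = real m / 2"
    using assms by auto
  ultimately show ?thesis by simp
qed

text \<open>In the constant \<open>9 / 2\<close>, the 4 comes from the upper bound on the mixing
  time and the 1/2 from the sum of inverse rates. The bound on \<open>s\<close> guarantees that
  \<open>s\<close> precedes the mixing time.\<close>

lemma max_local_time_bounds:
  assumes mix: "sqrt vol * exp (- gap * (4 * deg * (real m)\<^sup>2)) \<le> 1 / 8"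
    and s: "0 \<le> s" "s \<le> (real m)\<^sup>2 * ln 2 * deg / (4 * pi\<^sup>2)"
  shows "0 \<le> (MAX v\<in>pverts \<Gamma>. LINT \<omega>|walk_space \<Gamma>. local_time v v (mixing_time \<Gamma> (1/4)) \<omega> - local_time v v s \<omega>)"
    and "(MAX v\<in>pverts \<Gamma>. LINT \<omega>|walk_space \<Gamma>. local_time v v (mixing_time \<Gamma> (1/4)) \<omega> - local_time v v s \<omega>)
      \<le> 9 / 2 * deg * (real m)\<^sup>2 / vol + exp (- gap * s) / gap"
proof -
  let ?T = "mixing_time \<Gamma> (1/4)"
  let ?E = "\<lambda>v. LINT \<omega>|walk_space \<Gamma>. local_time v v ?T \<omega> - local_time v v s \<omega>"
  have T: "?T \<le> 4 * deg * (real m)\<^sup>2" "s \<le> ?T"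
    using mixing_time_upper_lower[OF mix] s(2) by auto
  have E: "?E v = integral {s..?T} (\<lambda>u. heat \<Gamma> u (indicator {v}) v)" if "v \<in> pverts \<Gamma>" for v
    by (rule expectation_local_time_diff[OF that s(1) T(2)])
  have "9 / 2 * deg * (real m)\<^sup>2 = 4 * deg * (real m)\<^sup>2 + deg * (real m)\<^sup>2 / 2"
    by (simp add: field_simps)
  then have "?T + deg * (real m)\<^sup>2 / 2 \<le> 9 / 2 * deg * (real m)\<^sup>2"
    using T(1) by (simp only: add_right_mono)
  then have "(?T + deg * (real m)\<^sup>2 / 2) / vol \<le> 9 / 2 * deg * (real m)\<^sup>2 / vol"
    using vol_pos by (intro divide_right_mono) simp_all
  then have bounds: "0 \<le> ?E v" "?E v \<le> 9 / 2 * deg * (real m)\<^sup>2 / vol + exp (- gap * s) / gap"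
    if "v \<in> pverts \<Gamma>" for v
    using integral_return_probability[OF that s(1) T(2)] unfolding E[OF that] by linarith+
  obtain v where v: "v \<in> pverts \<Gamma>" using vertices_nonempty by blast
  show "0 \<le> (MAX v\<in>pverts \<Gamma>. ?E v)"
    by (rule order_trans[OF bounds(1)[OF v] Max_ge[OF finite_imageI[OF finite_vertices] imageI[OF v, of ?E]]])
  show "(MAX v\<in>pverts \<Gamma>. ?E v) \<le> 9 / 2 * deg * (real m)\<^sup>2 / vol + exp (- gap * s) / gap"
    using bounds(2) finite_vertices vertices_nonempty by (intro Max.boundedI) auto
qed

end

section \<open>Passage to the limit along the index set\<close>

theorem proposition6p1:
  fixes M :: "nat set"
    and Grp :: "nat \<Rightarrow> ('a, 'b) monoid_scheme"
    and S :: "nat \<Rightarrow> 'a set"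
    and h :: "nat \<Rightarrow> real"
    and k :: nat
    and \<Gamma> :: "nat \<Rightarrow> (nat \<times> 'a) pair_pre_digraph"
  assumes "infinite M"
    and "\<And>m. m \<in> M \<Longrightarrow> even m \<and> m \<ge> 2"
    and "k > 3"
    and "\<And>m. m \<in> M \<Longrightarrow> group (Grp m) \<and> finite (carrier (Grp m))"
    and "\<And>m. m \<in> M \<Longrightarrow> connection_set (Grp m) (S m)"
    and "\<And>m. m \<in> M \<Longrightarrow> ramanujan k (cayley_graph (Grp m) (S m))"
    and "\<And>m. m \<in> M \<Longrightarrow> 1 \<le> h m \<and> h m \<le> real m"
    and "\<And>m. m \<in> M \<Longrightarrow> real (card (carrier (Grp m))) = real m * h m"
    and "\<And>m. m \<in> M \<Longrightarrow> \<Gamma> m = cartesian_product (cycle_graph m) (cayley_graph (Grp m) (S m))"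
    and "filterlim h at_top (at_top_along M)"
    and "h \<in> O[at_top_along M](\<lambda>m. ln (real m))"
  shows "strongly_uniformly_transient M \<Gamma> \<and> \<not> diameter_condition M \<Gamma>"
proof
  let ?F = "at_top_along M"
  define D where "D = real k + 2"
  define g where "g = cycle_times_ramanujan.gap k"
  have torus: "cycle_times_ramanujan m k (cayley_graph (Grp m) (S m))" if "m \<in> M" "3 \<le> m" for m
    using that assms(3,6) by (simp add: cycle_times_ramanujan_def)
  have volume: "real (card (pverts (\<Gamma> m))) = (real m)\<^sup>2 * h m" if "m \<in> M" for m
    using assms(8,9)[OF that]
    by (simp add: pverts_cartesian_product card_cartesian_product cycle_graph_def cayley_graph_def power2_eq_square)
  \<comment> \<open>On the trivial filter \<open>Limsup\<close> would be minus infinity and every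
    convergence would hold.\<close>
  have nontrivial: "?F \<noteq> bot"
  proof
    assume "?F = bot"
    then have "eventually (\<lambda>_. False) ?F"
      by simp
    then have "eventually (\<lambda>m. m \<notin> M) at_top"
      by (simp add: eventually_inf_principal)
    with assms(1) show False
      by (auto simp: eventually_at_top_linorder infinite_nat_iff_unbounded_le)
  qed
  have M: "eventually (\<lambda>m. m \<in> M \<and> 3 \<le> m) ?F"
    unfolding eventually_inf_principal using eventually_ge_at_top[of 3] by eventually_elim simp
  \<comment> \<open>The gap depends on \<open>k\<close> alone, but its positivity is available only
    inside the locale, so one instance is fixed to extract it.\<close>
  obtain m0 where "m0 \<in> M" "3 \<le> m0"
    using eventually_happens[OF M] nontrivial by blast
  then interpret T0: cycle_times_ramanujan m0 k "cayley_graph (Grp m0) (S m0)"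
    by (rule torus)
  have g: "0 < g" and D: "0 < D"
    using T0.gap_pos by (simp_all add: g_def D_def)

  show "strongly_uniformly_transient M \<Gamma>"
    unfolding strongly_uniformly_transient_def
  proof (rule tendsto_sandwich)
    let ?V = "\<lambda>s m. MAX x\<in>pverts (\<Gamma> m). LINT \<omega>|walk_space (\<Gamma> m).
        local_time x x (mixing_time (\<Gamma> m) (1/4)) \<omega> - local_time x x s \<omega>"
    have "eventually (\<lambda>m::nat. (real m)\<^sup>2 * exp (- g * (4 * D * (real m)\<^sup>2)) \<le> 1 / 8) at_top"
      using g D by real_asymp
    then have mix: "eventually (\<lambda>m. (real m)\<^sup>2 * exp (- g * (4 * D * (real m)\<^sup>2)) \<le> 1 / 8) ?F"
      by (rule filter_leD[OF inf_le1])
    have bounds: "eventually (\<lambda>m. 0 \<le> ?V s m \<and> ?V s m \<le> 9 / 2 * D / h m + exp (- g * s) / g) ?F" if s: "0 \<le> s" for s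
    proof -
      \<comment> \<open>For fixed \<open>s\<close> the lower bound on the mixing time eventually
        exceeds \<open>s\<close>.\<close>
      have "filterlim (\<lambda>m::nat. (real m)\<^sup>2 * ln 2 * D / (4 * pi\<^sup>2)) at_top at_top"
        using D by real_asymp
      then have "eventually (\<lambda>m::nat. s \<le> (real m)\<^sup>2 * ln 2 * D / (4 * pi\<^sup>2)) at_top"
        by (simp add: filterlim_at_top)
      then have "eventually (\<lambda>m. s \<le> (real m)\<^sup>2 * ln 2 * D / (4 * pi\<^sup>2)) ?F"
        by (rule filter_leD[OF inf_le1])
      from this mix M show ?thesis
      proof eventually_elim
        case (elim m)
        then have mM: "m \<in> M" and hm: "1 \<le> h m" "h m \<le> real m"
          using assms(7) by auto
        interpret cycle_times_ramanujan m k "cayley_graph (Grp m) (S m)"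
          using elim by (intro torus) auto
        note eq = assms(9)[OF mM]
        have vol: "real (card (pverts (\<Gamma> m))) = (real m)\<^sup>2 * h m"
          by (rule volume[OF mM])
        \<comment> \<open>From \<open>h m \<le> m\<close> the volume is at most \<open>m^3\<close>,
          hence at most \<open>m^4\<close>.\<close>
        have "sqrt (real (card (pverts (\<Gamma> m)))) \<le> (real m)\<^sup>2"
        proof (rule real_le_lsqrt)
          have "real m \<le> (real m)\<^sup>2"
            using elim by (intro self_le_power) auto
          then have "(real m)\<^sup>2 * h m \<le> (real m)\<^sup>2 * (real m)\<^sup>2"
            using hm by (intro mult_left_mono order_trans[OF hm(2)]) simp_all
          then show "real (card (pverts (\<Gamma> m))) \<le> ((real m)\<^sup>2)\<^sup>2"
            unfolding vol by (simp add: power2_eq_square)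
        qed simp
        then have "sqrt (real (card (pverts (\<Gamma> m)))) * exp (- g * (4 * D * (real m)\<^sup>2))
            \<le> (real m)\<^sup>2 * exp (- g * (4 * D * (real m)\<^sup>2))"
          by (rule mult_right_mono) simp
        then have "sqrt (real (card (pverts (\<Gamma> m)))) * exp (- g * (4 * D * (real m)\<^sup>2)) \<le> 1 / 8"
          using elim by linarith
        moreover have "9 / 2 * D * (real m)\<^sup>2 / real (card (pverts (\<Gamma> m))) = 9 / 2 * D / h m"
          unfolding vol using elim by simp
        ultimately show ?case
          using max_local_time_bounds[of s] s elim unfolding eq[symmetric] g_def[symmetric] D_def[symmetric]
          by simp
      qed
    qed
    show "eventually (\<lambda>s. 0 \<le> Limsup ?F (\<lambda>m. ereal (?V s m))) at_top"
      using eventually_ge_at_top[of 0]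
    proof eventually_elim
      case (elim s)
      show ?case
        by (rule le_Limsup[OF nontrivial]) (use bounds[OF elim] in eventually_elim, simp)
    qed
    show "eventually (\<lambda>s. Limsup ?F (\<lambda>m. ereal (?V s m)) \<le> ereal (exp (- g * s) / g)) at_top"
      using eventually_ge_at_top[of 0]
    proof eventually_elim
      case (elim s)
      \<comment> \<open>Here \<open>h\<close> tending to infinity removes the contribution of the
        waves; the remainder survives and vanishes only as \<open>s\<close> grows.\<close>
      have "((\<lambda>m. 9 / 2 * D / h m + exp (- g * s) / g) \<longlongrightarrow> 0 + exp (- g * s) / g) ?F"
        by (intro tendsto_add tendsto_const real_tendsto_divide_at_top[OF tendsto_const assms(10)])
      then have "((\<lambda>m. ereal (9 / 2 * D / h m + exp (- g * s) / g)) \<longlongrightarrow> ereal (exp (- g * s) / g)) ?F"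
        by simp
      then have "Limsup ?F (\<lambda>m. ereal (9 / 2 * D / h m + exp (- g * s) / g)) = ereal (exp (- g * s) / g)"
        by (rule lim_imp_Limsup[OF nontrivial])
      moreover have "Limsup ?F (\<lambda>m. ereal (?V s m)) \<le> Limsup ?F (\<lambda>m. ereal (9 / 2 * D / h m + exp (- g * s) / g))"
        by (rule Limsup_mono) (use bounds[OF elim] in eventually_elim, simp)
      ultimately show ?case by simp
    qed
    show "((\<lambda>s. ereal (exp (- g * s) / g)) \<longlongrightarrow> 0) at_top"
      unfolding zero_ereal_def lim_ereal using g by real_asymp
  qed (rule tendsto_const)

  show "\<not> diameter_condition M \<Gamma>"
  proof
    assume "diameter_condition M \<Gamma>"
    obtain C where C: "0 < C" "eventually (\<lambda>m. norm (h m) \<le> C * norm (ln (real m))) ?F"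
      using landau_o.bigE[OF assms(11)] by blast
    \<comment> \<open>The constant arises as \<open>(m/2)^2 ln m / (m^2 h) = ln m / (4 h)\<close>
      together with \<open>h \<le> C ln m\<close>; the volume is at least \<open>m\<close>, so its
      logarithm may be replaced by \<open>ln m\<close>.\<close>
    have "eventually (\<lambda>m. 1 / (4 * C) \<le> (diam (\<Gamma> m))\<^sup>2 * ln (real (card (pverts (\<Gamma> m)))) / real (card (pverts (\<Gamma> m)))) ?F"
      using C(2) M
    proof eventually_elim
      case (elim m)
      then have mM: "m \<in> M" "3 \<le> m" and hm: "1 \<le> h m"
        using assms(7) by auto
      interpret cycle_times_ramanujan m k "cayley_graph (Grp m) (S m)"
        using mM by (rule torus)
      have ln_pos: "0 < ln (real m)"
        using mM by simp
      have hC: "h m \<le> C * ln (real m)"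
        using elim ln_pos hm by simp
      have "real m * 1 \<le> real m * (real m * h m)"
        using mM hm mult_mono[of 1 "real m" 1 "h m"] by (intro mult_left_mono) auto
      then have ln_le: "ln (real m) \<le> ln ((real m)\<^sup>2 * h m)"
        using mM hm by (subst ln_le_cancel_iff) (auto simp: power2_eq_square mult.assoc)
      have "(real m / 2)\<^sup>2 \<le> (diam (\<Gamma> m))\<^sup>2"
        unfolding assms(9)[OF mM(1)] using diam_product_ge assms(2)[OF mM(1)] by (intro power_mono) auto
      then have "(real m / 2)\<^sup>2 * ln (real m) \<le> (diam (\<Gamma> m))\<^sup>2 * ln ((real m)\<^sup>2 * h m)"
        using ln_le ln_pos by (intro mult_mono) auto
      moreover have "1 / (4 * C) * ((real m)\<^sup>2 * h m) \<le> (real m / 2)\<^sup>2 * ln (real m)"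
      proof -
        have "(real m)\<^sup>2 * h m / (4 * C) \<le> (real m)\<^sup>2 * (C * ln (real m)) / (4 * C)"
          using C(1) hC by (intro divide_right_mono mult_left_mono) auto
        then show ?thesis
          using C(1) by (simp add: power_divide)
      qed
      ultimately have "1 / (4 * C) * ((real m)\<^sup>2 * h m) \<le> (diam (\<Gamma> m))\<^sup>2 * ln ((real m)\<^sup>2 * h m)"
        by linarith
      moreover have "0 < (real m)\<^sup>2 * h m"
        using mM hm by simp
      ultimately show ?case
        unfolding volume[OF mM(1)] by (subst pos_le_divide_eq)
    qed
    moreover have "eventually (\<lambda>m. (diam (\<Gamma> m))\<^sup>2 * ln (real (card (pverts (\<Gamma> m)))) / real (card (pverts (\<Gamma> m))) < 1 / (4 * C)) ?F"
      using \<open>diameter_condition M \<Gamma>\<close> C(1) unfolding diameter_condition_def by (intro order_tendstoD(2)) auto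
    ultimately have "eventually (\<lambda>m. False) ?F"
      by eventually_elim simp
    with nontrivial show False
      by simp
  qed
qed

end
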